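(* The stashing operation $f\mapsto\Sigma f$ is an interior operator with respect to each of the reducibilities $\leq_{\mathrm W}$, $\leq_{\mathrm{sW}}$, $\leq_{\mathrm W}^*$ and $\leq_{\mathrm{sW}}^*$. That is, writing $\leq$ for any one of these four relations, for all problems $f,g$: (1) $\Sigma f\leq f$; (2) $f\leq g$ implies $\Sigma f\leq\Sigma g$; (3) $\Sigma f\leq\Sigma\Sigma f$.
   Context: A represented space is a set $X$ with a partial surjective map $\delta_X:\subseteq\mathbb N^{\mathbb N}\to X$ (its representation); $p$ with $\delta_X(p)=x$ is called a name of $x$. A problem is a partial multi-valued function $f:\subseteq X\rightrightarrows Y$ between represented spaces that has a realizer; a realizer of $f$ is a function $F:\subseteq\mathbb N^{\mathbb N}\to\mathbb N^{\mathbb N}$ with $\delta_YF(p)\in f\delta_X(p)$ for all $p\in\mathrm{dom}(f\delta_X)$. For $p,q\in\mathbb N^{\mathbb N}$, $\langle p,q\rangle(2n)=p(n)$ and $\langle p,q\rangle(2n+1)=q(n)$. For problems $f,g$: $f\leq_{\mathrm W}g$ if there are computable $H,K:\subseteq\mathbb N^{\mathbb N}\to\mathbb N^{\mathbb N}$ such that $H\langle\mathrm{id},GK\rangle$ is a realizer of $f$ whenever $G$ is a realizer of $g$; $f\leq_{\mathrm{sW}}g$ is defined in the same way with $HGK$ instead of $H\langle\mathrm{id},GK\rangle$. The topological versions $\leq_{\mathrm W}^*$ and $\leq_{\mathrm{sW}}^*$ are defined with continuous instead of computable $H,K$. Completion: for a represented space $(Y,\delta_Y)$, $\overline Y:=Y\cup\{\bot\}$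 with $\bot\notin Y$, represented by the total map $\delta_{\overline Y}:\mathbb N^{\mathbb N}\to\overline Y$ with $\delta_{\overline Y}(p)=\delta_Y(p-1)$ if $p-1\in\mathrm{dom}(\delta_Y)$ and $\delta_{\overline Y}(p)=\bot$ otherwise. Here $p-1\in\mathbb N^{\mathbb N}\cup\mathbb N^*$ is the finite or infinite sequence obtained by concatenating $p(0)-1,p(1)-1,\dots$, where $0-1$ is the empty word. The sequence space $X^{\mathbb N}$ is represented by $\langle p_0,p_1,\dots\rangle\mapsto(\delta_X(p_n))_n$, where $\langle p_0,p_1,\dots\rangle\langle n,k\rangle:=p_n(k)$ and $\langle n,k\rangle:=\frac12(n+k)(n+k+1)+k$ for $n,k\in\mathbb N$. Stashing: for $f:\subseteq X\rightrightarrows Y$, $\Sigma f:\subseteq X^{\mathbb N}\rightrightarrows\overline Y^{\mathbb N}$ has $\mathrm{dom}(\Sigma f)=\mathrm{dom}(f)^{\mathbb N}$ and $\Sigma f((x_n)_n)=\{(y_n)_n\in\overline Y^{\mathbb N}:(\exists n)\ y_n\in f(x_n)\}$. *)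

theory Defs
  imports "HOL-Analysis.Function_Topology" "HOL-Library.Infinite_Set"
begin

type_synonym baire = "nat \<Rightarrow> nat"


section \<open>Computable and continuous partial functions on Baire space\<close>

text \<open>
  Partial recursive functions relative to a function \<open>p\<close> (Kleene's schemata with the additional
  basic function \<open>p\<close>, denoted by \<open>Query\<close>). Arguments are passed as a list; \<open>Mu\<close> searches for
  and \<open>PrimRec\<close> recurses on the head of that list. \<open>eval p e xs y\<close> means that the term \<open>e\<close> applied
  to \<open>xs\<close> converges with value \<open>y\<close>.
\<close>

datatype recf =
    Zero
  | Succ
  | Proj nat
  | Query
  | Comp recf "recf list"
  | PrimRec recf recf
  | Mu recf

inductive eval :: "baire \<Rightarrow> recf \<Rightarrow> nat list \<Rightarrow> nat \<Rightarrow> bool" for p :: baire where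
  zero: "eval p Zero xs 0"
| succ: "eval p Succ [x] (Suc x)"
| proj: "i < length xs \<Longrightarrow> eval p (Proj i) xs (xs ! i)"
| query: "eval p Query [x] (p x)"
| comp: "list_all2 (\<lambda>g y. eval p g xs y) gs ys \<Longrightarrow> eval p f ys z \<Longrightarrow> eval p (Comp f gs) xs z"
| primrec_0: "eval p f xs z \<Longrightarrow> eval p (PrimRec f g) (0 # xs) z"
| primrec_Suc: "eval p (PrimRec f g) (n # xs) y \<Longrightarrow> eval p g (n # y # xs) z
    \<Longrightarrow> eval p (PrimRec f g) (Suc n # xs) z"
| mu: "eval p f (n # xs) 0 \<Longrightarrow> (\<forall>m<n. \<exists>y. eval p f (m # xs) (Suc y)) \<Longrightarrow> eval p (Mu f) xs n"

lemma eval_deterministic: "eval p e xs y \<Longrightarrow> eval p e xs z \<Longrightarrow> y = z"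
proof (induction arbitrary: z rule: eval.induct)
  case (comp xs gs ys f w)
  from comp.prems obtain ys' where ys': "list_all2 (\<lambda>g y. eval p g xs y) gs ys'" "eval p f ys' z"
    by cases auto
  have "ys = ys'"
    using comp(1) ys'(1) by (auto simp: list_all2_conv_all_nth intro!: nth_equalityI)
  then show ?case using comp.IH ys'(2) by blast
next case (mu f n xs)
  from mu.prems obtain "eval p f (z # xs) 0" "\<forall>m<z. \<exists>y. eval p f (m # xs) (Suc y)" by cases auto
  with mu.IH show ?case by (metis linorder_neqE_nat nat.distinct(1))
next case zero from zero.prems show ?case by cases auto
next case succ from succ.prems show ?case by cases auto
next case proj from proj.prems show ?case by cases auto
next case query from query.prems show ?case by cases auto
next case primrec_0 from primrec_0.prems show ?case using primrec_0.IH by cases auto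
next case primrec_Suc from primrec_Suc.prems show ?case using primrec_Suc.IH by cases auto
qed

text \<open>
  As usual for partial functions on Baire space, the algorithm has to be correct on the
  domain of F only; no condition is imposed on its behaviour outside of the domain.
\<close>

definition computable :: "(baire \<rightharpoonup> baire) \<Rightarrow> bool" where
  "computable F \<longleftrightarrow> (\<exists>e. \<forall>p q. F p = Some q \<longrightarrow> (\<forall>n. eval p e [n] (q n)))"

text \<open>The topology on \<^typ>\<open>nat \<Rightarrow> nat\<close> is the product topology of the discrete topology.\<close>

definition continuous_partial :: "(baire \<rightharpoonup> baire) \<Rightarrow> bool" where
  "continuous_partial F \<longleftrightarrow> continuous_on (dom F) (\<lambda>p. the (F p))"


section \<open>Represented spaces and problems\<close>

text \<open>
  A represented space is given by its representation \<open>\<delta>\<close>; by surjectivity its underlying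
  set is \<^term>\<open>ran \<delta>\<close>.
\<close>

type_synonym 'a rep = "baire \<rightharpoonup> 'a"

text \<open>
  A partial multi-valued function is a relation between the two spaces; its domain consists of
  the points with a nonempty set of values.
\<close>

record ('a, 'b) mvfun =
  in_rep :: "'a rep"
  out_rep :: "'b rep"
  vals :: "'a \<Rightarrow> 'b set"

definition mdom :: "('a, 'b) mvfun \<Rightarrow> 'a set" where
  "mdom f = {x. vals f x \<noteq> {}}"

definition realizer :: "(baire \<rightharpoonup> baire) \<Rightarrow> ('a, 'b) mvfun \<Rightarrow> bool" where
  "realizer F f \<longleftrightarrow>
     (\<forall>p x. in_rep f p = Some x \<and> x \<in> mdom f \<longrightarrow>
        (\<exists>q y. F p = Some q \<and> out_rep f q = Some y \<and> y \<in> vals f x))"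

definition problem :: "('a, 'b) mvfun \<Rightarrow> bool" where
  "problem f \<longleftrightarrow>
     mdom f \<subseteq> ran (in_rep f) \<and> (\<forall>x. vals f x \<subseteq> ran (out_rep f)) \<and> (\<exists>F. realizer F f)"


section \<open>Weihrauch reducibilities\<close>

definition pair :: "baire \<Rightarrow> baire \<Rightarrow> baire" where
  "pair p q m = (if even m then p (m div 2) else q (m div 2))"

text \<open>The partial function \<open>\<langle>id, F\<rangle>\<close>.\<close>

definition pair_id :: "(baire \<rightharpoonup> baire) \<Rightarrow> (baire \<rightharpoonup> baire)" where
  "pair_id F p = map_option (pair p) (F p)"

definition reducible_via ::
    "((baire \<rightharpoonup> baire) \<Rightarrow> bool) \<Rightarrow> ('a, 'b) mvfun \<Rightarrow> ('c, 'd) mvfun \<Rightarrow> bool" where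
  "reducible_via C f g \<longleftrightarrow>
     (\<exists>H K. C H \<and> C K \<and> (\<forall>G. realizer G g \<longrightarrow> realizer (H \<circ>\<^sub>m pair_id (G \<circ>\<^sub>m K)) f))"

definition strongly_reducible_via ::
    "((baire \<rightharpoonup> baire) \<Rightarrow> bool) \<Rightarrow> ('a, 'b) mvfun \<Rightarrow> ('c, 'd) mvfun \<Rightarrow> bool" where
  "strongly_reducible_via C f g \<longleftrightarrow>
     (\<exists>H K. C H \<and> C K \<and> (\<forall>G. realizer G g \<longrightarrow> realizer (H \<circ>\<^sub>m (G \<circ>\<^sub>m K)) f))"

definition W_le :: "('a, 'b) mvfun \<Rightarrow> ('c, 'd) mvfun \<Rightarrow> bool" (infix "\<le>\<^sub>W" 50) where
  "f \<le>\<^sub>W g \<longleftrightarrow> reducible_via computable f g"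

definition sW_le :: "('a, 'b) mvfun \<Rightarrow> ('c, 'd) mvfun \<Rightarrow> bool" (infix "\<le>\<^sub>s\<^sub>W" 50) where
  "f \<le>\<^sub>s\<^sub>W g \<longleftrightarrow> strongly_reducible_via computable f g"

definition W_top_le :: "('a, 'b) mvfun \<Rightarrow> ('c, 'd) mvfun \<Rightarrow> bool" (infix "\<le>\<^sub>W\<^sup>*" 50) where
  "f \<le>\<^sub>W\<^sup>* g \<longleftrightarrow> reducible_via continuous_partial f g"

definition sW_top_le :: "('a, 'b) mvfun \<Rightarrow> ('c, 'd) mvfun \<Rightarrow> bool" (infix "\<le>\<^sub>s\<^sub>W\<^sup>*" 50) where
  "f \<le>\<^sub>s\<^sub>W\<^sup>* g \<longleftrightarrow> strongly_reducible_via continuous_partial f g"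


section \<open>Completion, sequence spaces and stashing\<close>

text \<open>
  \<open>minus_one p\<close> is the sequence \<open>p - 1\<close> obtained by deleting all zeros of \<open>p\<close> and decreasing
  the remaining entries by one, and \<^const>\<open>None\<close> if that sequence is finite. Finite
  sequences never belong to the domain of a representation, so they need not be distinguished.
\<close>

definition minus_one :: "baire \<rightharpoonup> baire" where
  "minus_one p =
     (let S = {k. p k \<noteq> 0} in if infinite S then Some (\<lambda>n. p (enumerate S n) - 1) else None)"

text \<open>
  The completion of a space with underlying type \<open>'b\<close> has the underlying type \<open>'b option\<close>,
  where \<^const>\<open>None\<close> is the bottom element and \<open>Some y\<close> stands for \<open>y\<close>. The outer
  \<^const>\<open>Some\<close> says that the representation is total; the value is bottom whenever
  \<open>p - 1\<close> is not in the domain of \<open>\<delta>\<close>.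
\<close>

definition completion :: "'b rep \<Rightarrow> 'b option rep" where
  "completion \<delta> p = Some ((\<delta> \<circ>\<^sub>m minus_one) p)"

definition tuple_index :: "nat \<Rightarrow> nat \<Rightarrow> nat" where
  "tuple_index n k = (n + k) * (n + k + 1) div 2 + k"

text \<open>
  Since \<^const>\<open>tuple_index\<close> is a bijection, every \<open>p\<close> is \<open>\<langle>p\<^sub>0, p\<^sub>1, \<dots>\<rangle>\<close> for exactly one sequence
  of components \<open>p\<^sub>n\<close>, namely \<open>p\<^sub>n = component n p\<close>.
\<close>

definition component :: "nat \<Rightarrow> baire \<Rightarrow> baire" where
  "component n p k = p (tuple_index n k)"

definition seq_rep :: "'a rep \<Rightarrow> (nat \<Rightarrow> 'a) rep" where
  "seq_rep \<delta> p =
     (if \<forall>n. component n p \<in> dom \<delta> then Some (\<lambda>n. the (\<delta> (component n p))) else None)"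

definition stash :: "('a, 'b) mvfun \<Rightarrow> (nat \<Rightarrow> 'a, nat \<Rightarrow> 'b option) mvfun" where
  "stash f = \<lparr>
     in_rep = seq_rep (in_rep f),
     out_rep = seq_rep (completion (out_rep f)),
     vals = (\<lambda>x. if \<forall>n. x n \<in> mdom f
       then {y. (\<forall>n. y n \<in> ran (completion (out_rep f))) \<and> (\<exists>n. \<exists>z \<in> vals f (x n). y n = Some z)}
       else {}) \<rparr>"

end

theory Submission
  imports Defs "HOL-Library.Nat_Bijection"
begin

text \<open>
  For \<open>\<Sigma>f \<le> f\<close> one answers the first question only, and for \<open>\<Sigma>f \<le> \<Sigma>\<Sigma>f\<close> one arranges the questions
  in a square by means of the pairing function. The crucial point is monotonicity: given a sequence
  of names in the completed space, of which only one is known to be meaningful, the output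
  has to be a total sequence. So \<open>H\<close> is run on all components in parallel, with \<open>0\<close> as the output
  wherever no new value is available yet; since \<open>0\<close> is ignored by the completion, the components on
  which \<open>H\<close> converges come out right and the others do no harm.

  The only property of computable and of continuous functions \<open>F\<close> that is needed is that the
  values of \<open>F\<close> can be found in stages by a total functional from stagewise information on the
  argument. For computable functions this is evaluation with bounded fuel, for continuous ones it
  is forcing by a finite part of the argument.
\<close>

section \<open>Classes of total functionals closed under primitive recursion\<close>

text \<open>Two obstacles shape the proof. The reducibilities quantify over all realizers
  \<open>G\<close>, but a realizer of \<open>stash g\<close> does not split into realizers of
  \<open>g\<close>: which component it answers correctly may vary with the whole sequence. So
  reductions are first restated for single names (\<open>reduces\<close>), and this is where the
  existence of a realizer, part of \<open>problem g\<close>, is needed. Secondly, nothing is known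
  about \<open>H\<close> off its domain, and a meaningless component may lie there. So
  \<open>H\<close> is replaced by a total functional of stages, whose answers need to be right only
  for arguments in the domain of \<open>H\<close>. The coding of answers, \<open>0\<close> for
  unknown and \<open>Suc v\<close> for \<open>v\<close>, is that of the completion, where
  \<open>0\<close> is deleted and the other entries are lowered by one; a stream of stagewise
  answers is thus nearly a name already. All stagewise constructions use only closure under
  primitive recursion; unbounded search enters through \<open>eff_search\<close> alone.\<close>

locale primrec_class =
  fixes tot :: "nat \<Rightarrow> (baire \<Rightarrow> nat list \<Rightarrow> nat) \<Rightarrow> bool"
  assumes tot_cong: "tot a \<phi> \<Longrightarrow> (\<And>p xs. length xs = a \<Longrightarrow> \<phi> p xs = \<psi> p xs) \<Longrightarrow> tot a \<psi>"
    and tot_zero: "tot a (\<lambda>p xs. 0)"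
    and tot_Suc: "tot a \<alpha> \<Longrightarrow> tot a (\<lambda>p xs. Suc (\<alpha> p xs))"
    and tot_nth: "i < a \<Longrightarrow> tot a (\<lambda>p xs. xs ! i)"
    and tot_query: "tot a \<alpha> \<Longrightarrow> tot a (\<lambda>p xs. p (\<alpha> p xs))"
    and tot_comp: "tot b \<phi> \<Longrightarrow> (\<And>p xs. length xs = a \<Longrightarrow> length (\<rho> p xs) = b)
      \<Longrightarrow> (\<And>i. i < b \<Longrightarrow> tot a (\<lambda>p xs. \<rho> p xs ! i)) \<Longrightarrow> tot a (\<lambda>p xs. \<phi> p (\<rho> p xs))"
    and tot_primrec: "tot a \<phi> \<Longrightarrow> tot (Suc (Suc a)) \<psi>
      \<Longrightarrow> tot (Suc a) (\<lambda>p xs. rec_nat (\<phi> p (tl xs)) (\<lambda>m y. \<psi> p (m # y # tl xs)) (hd xs))"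
begin

lemma tot_drop2: "tot a \<phi> \<Longrightarrow> tot (Suc (Suc a)) (\<lambda>p xs. \<phi> p (drop 2 xs))"
  by (rule tot_comp) (auto intro!: tot_cong[OF tot_nth[of "Suc (Suc _)"]])

lemma tot_drop_nth: "i + k < a \<Longrightarrow> tot a (\<lambda>p xs. drop k xs ! i)"
  by (rule tot_cong[OF tot_nth[of "k + i"]]) auto

text \<open>\<open>tot_primrec\<close> recurses on the head of the list, so the value of
  \<open>\<kappa>\<close> is put in front of the parameters. The step is described by positions in
  \<open>ys\<close> so that membership of a \<open>rec_nat\<close> expression can be proved by
  introduction rules.\<close>

lemma tot_rec_nat:
  assumes "tot a \<phi>" "tot (Suc (Suc a)) (\<lambda>p ys. \<psi> p (ys ! 0) (ys ! 1) (drop 2 ys))" "tot a \<kappa>"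
  shows "tot a (\<lambda>p xs. rec_nat (\<phi> p xs) (\<lambda>m y. \<psi> p m y xs) (\<kappa> p xs))"
proof -
  have "tot a (\<lambda>p xs. (\<lambda>p xs. rec_nat (\<phi> p (tl xs))
      (\<lambda>m y. \<psi> p ((m # y # tl xs) ! 0) ((m # y # tl xs) ! 1) (drop 2 (m # y # tl xs))) (hd xs))
        p (\<kappa> p xs # xs))"
  proof (rule tot_comp[OF tot_primrec[OF assms(1,2)]])
    show "tot a (\<lambda>p xs. (\<kappa> p xs # xs) ! i)" if "i < Suc a" for i
      using that assms(3) by (cases i) (auto intro: tot_nth)
  qed simp
  then show ?thesis by (rule tot_cong) simp
qed

lemma tot_const: "tot a (\<lambda>p xs. c)"
  by (induction c) (auto intro: tot_zero tot_Suc)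

lemma tot_if_zero:
  assumes "tot a \<kappa>" "tot a \<phi>" "tot a \<psi>"
  shows "tot a (\<lambda>p xs. if \<kappa> p xs = 0 then \<phi> p xs else \<psi> p xs)"
proof -
  have "tot a (\<lambda>p xs. rec_nat (\<phi> p xs) (\<lambda>m y. \<psi> p xs) (\<kappa> p xs))"
    by (intro tot_rec_nat tot_drop2 assms)
  then show ?thesis
    by (rule tot_cong) (metis not0_implies_Suc old.nat.simps(6) old.nat.simps(7))
qed

lemma tot_pred: "tot a \<phi> \<Longrightarrow> tot a (\<lambda>p xs. \<phi> p xs - 1)"
proof -
  assume "tot a \<phi>"
  then have "tot a (\<lambda>p xs. rec_nat 0 (\<lambda>m y. m) (\<phi> p xs))"
    by (intro tot_rec_nat tot_zero tot_nth) auto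
  moreover have "rec_nat 0 (\<lambda>m y. m) n = n - 1" for n :: nat by (cases n) auto
  ultimately show ?thesis by simp
qed

lemma tot_add:
  assumes "tot a \<phi>" "tot a \<psi>"
  shows "tot a (\<lambda>p xs. \<phi> p xs + \<psi> p xs)"
proof -
  have "tot a (\<lambda>p xs. rec_nat (\<phi> p xs) (\<lambda>m y. Suc y) (\<psi> p xs))"
    by (intro tot_rec_nat assms tot_Suc tot_nth) auto
  moreover have "rec_nat k (\<lambda>m y. Suc y) n = k + n" for k n :: nat by (induction n) auto
  ultimately show ?thesis by simp
qed

lemma tot_diff:
  assumes "tot a \<phi>" "tot a \<psi>"
  shows "tot a (\<lambda>p xs. \<phi> p xs - \<psi> p xs)"
proof -
  have "tot a (\<lambda>p xs. rec_nat (\<phi> p xs) (\<lambda>m y. y - 1) (\<psi> p xs))"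
    by (intro tot_rec_nat assms tot_pred tot_nth) auto
  moreover have "rec_nat k (\<lambda>m y. y - 1) n = k - n" for k n :: nat by (induction n) auto
  ultimately show ?thesis by simp
qed

lemma tot_if_eq:
  assumes "tot a \<kappa>" "tot a \<mu>" "tot a \<phi>" "tot a \<psi>"
  shows "tot a (\<lambda>p xs. if \<kappa> p xs = \<mu> p xs then \<phi> p xs else \<psi> p xs)"
proof -
  have "tot a (\<lambda>p xs. if (\<kappa> p xs - \<mu> p xs) + (\<mu> p xs - \<kappa> p xs) = 0 then \<phi> p xs else \<psi> p xs)"
    by (intro tot_if_zero tot_add tot_diff assms)
  then show ?thesis by (rule tot_cong) auto
qed

lemma tot_if_le:
  assumes "tot a \<kappa>" "tot a \<mu>" "tot a \<phi>" "tot a \<psi>"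
  shows "tot a (\<lambda>p xs. if \<kappa> p xs \<le> \<mu> p xs then \<phi> p xs else \<psi> p xs)"
proof -
  have "tot a (\<lambda>p xs. if \<kappa> p xs - \<mu> p xs = 0 then \<phi> p xs else \<psi> p xs)"
    by (intro tot_if_zero tot_diff assms)
  then show ?thesis by (rule tot_cong) auto
qed

lemma tot_mod2: "tot a \<phi> \<Longrightarrow> tot a (\<lambda>p xs. \<phi> p xs mod 2)"
proof -
  assume "tot a \<phi>"
  then have "tot a (\<lambda>p xs. rec_nat 0 (\<lambda>m y. 1 - y) (\<phi> p xs))"
    by (intro tot_rec_nat tot_zero tot_nth tot_diff tot_const) auto
  moreover have "rec_nat 0 (\<lambda>m y. 1 - y) n = n mod 2" for n :: nat
    by (induction n) (simp, simp, presburger)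
  ultimately show ?thesis by simp
qed

lemma tot_div2: "tot a \<phi> \<Longrightarrow> tot a (\<lambda>p xs. \<phi> p xs div 2)"
proof -
  assume "tot a \<phi>"
  then have "tot a (\<lambda>p xs. rec_nat 0 (\<lambda>m y. y + m mod 2) (\<phi> p xs))"
    by (intro tot_rec_nat tot_zero tot_nth tot_add tot_mod2) auto
  moreover have "rec_nat 0 (\<lambda>m y. y + m mod 2) n = n div 2" for n :: nat
    by (induction n) (simp, simp, presburger)
  ultimately show ?thesis by simp
qed

lemma tot_triangle: "tot a \<phi> \<Longrightarrow> tot a (\<lambda>p xs. triangle (\<phi> p xs))"
proof -
  assume "tot a \<phi>"
  then have "tot a (\<lambda>p xs. rec_nat 0 (\<lambda>m y. y + Suc m) (\<phi> p xs))"
    by (intro tot_rec_nat tot_zero tot_nth tot_add tot_Suc) auto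
  moreover have "rec_nat 0 (\<lambda>m y. y + Suc m) n = triangle n" for n :: nat
    by (induction n) auto
  ultimately show ?thesis by simp
qed

end

section \<open>Decoding the Cantor pairing by primitive recursion\<close>

lemma tuple_index_prod_encode: "tuple_index n k = prod_encode (k, n)"
  by (simp add: tuple_index_def prod_encode_def triangle_def add.commute)

text \<open>The swap is due to \<open>prod_encode\<close> adding its first component to the
  triangular number, where \<open>tuple_index\<close> adds its second argument.\<close>

definition untuple :: "nat \<Rightarrow> nat \<times> nat" where
  "untuple m = prod.swap (prod_decode m)"

lemma tuple_index_untuple [simp]: "tuple_index (fst (untuple m)) (snd (untuple m)) = m"
  by (simp add: untuple_def tuple_index_prod_encode)

lemma untuple_tuple_index [simp]: "untuple (tuple_index n k) = (n, k)"
  by (simp add: untuple_def tuple_index_prod_encode)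

text \<open>The greatest \<open>w\<close> with \<open>triangle w \<le> m\<close>, from which both components of \<open>m\<close> can be read off.\<close>

definition triangle_root :: "nat \<Rightarrow> nat" where
  "triangle_root = rec_nat 0 (\<lambda>m w. if triangle (Suc w) \<le> Suc m then Suc w else w)"

text \<open>Passing from \<open>m\<close> to \<open>Suc m\<close> raises the root by at most one: if
  \<open>triangle (Suc w)\<close> is reached, it is reached exactly.\<close>

lemma triangle_root_bounds:
  "triangle (triangle_root m) \<le> m \<and> m < triangle (Suc (triangle_root m))"
  by (induction m) (auto simp: triangle_root_def)

lemma triangle_mono: "m \<le> n \<Longrightarrow> triangle m \<le> triangle n"
  by (induction n rule: nat_induct) (auto simp: le_Suc_eq)

lemma triangle_root_tuple_index: "triangle_root (tuple_index n k) = n + k"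
proof -
  have m: "tuple_index n k = triangle (n + k) + k"
    by (simp add: tuple_index_def triangle_def)
  define w where "w = triangle_root (tuple_index n k)"
  have w: "triangle w \<le> triangle (n + k) + k" "triangle (n + k) + k < triangle (Suc w)"
    using triangle_root_bounds[of "tuple_index n k"] unfolding w_def m by auto
  have "\<not> w < n + k"
    using w(2) triangle_mono[of "Suc w" "n + k"] by linarith
  moreover have "\<not> n + k < w"
  proof
    assume "n + k < w"
    then have "triangle (Suc (n + k)) \<le> triangle w" by (intro triangle_mono) simp
    then show False using w(1) by simp
  qed
  ultimately show ?thesis by (simp add: w_def)
qed

text \<open>Expresses decoding by operations under which the class is already closed.\<close>

lemma untuple_triangle_root:
  "snd (untuple m) = m - triangle (triangle_root m)"
  "fst (untuple m) = triangle_root m - (m - triangle (triangle_root m))"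
proof -
  obtain n k where m: "m = tuple_index n k" by (metis tuple_index_untuple)
  have "m - triangle (n + k) = k"
    by (simp add: m tuple_index_def triangle_def)
  moreover have "triangle_root m = n + k" "untuple m = (n, k)"
    by (simp_all only: m triangle_root_tuple_index untuple_tuple_index)
  ultimately show "snd (untuple m) = m - triangle (triangle_root m)"
    "fst (untuple m) = triangle_root m - (m - triangle (triangle_root m))"
    by simp_all
qed

context primrec_class
begin

lemma tot_triangle_root: "tot a \<phi> \<Longrightarrow> tot a (\<lambda>p xs. triangle_root (\<phi> p xs))"
  unfolding triangle_root_def
  by (intro tot_rec_nat tot_zero tot_if_le tot_triangle tot_Suc tot_nth) auto

lemma tot_untuple:
  assumes "tot a \<phi>"
  shows tot_fst_untuple: "tot a (\<lambda>p xs. fst (untuple (\<phi> p xs)))"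
    and tot_snd_untuple: "tot a (\<lambda>p xs. snd (untuple (\<phi> p xs)))"
  unfolding untuple_triangle_root
  by (intro tot_diff tot_triangle tot_triangle_root assms)+

lemma tot_tuple_index:
  assumes "tot a \<phi>" "tot a \<psi>"
  shows "tot a (\<lambda>p xs. tuple_index (\<phi> p xs) (\<psi> p xs))"
proof -
  have "tuple_index n k = triangle (n + k) + k" for n k
    by (simp add: tuple_index_def triangle_def)
  then show ?thesis by (simp add: tot_add tot_triangle assms)
qed

lemma tot_app3:
  assumes "tot 3 \<phi>" "tot a \<kappa>" "tot a \<mu>" "tot a \<nu>"
  shows "tot a (\<lambda>p xs. \<phi> p [\<kappa> p xs, \<mu> p xs, \<nu> p xs])"
  by (rule tot_comp[OF assms(1)])
    (auto simp: less_Suc_eq numeral_3_eq_3 nth_Cons' intro: assms)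

lemma tot_app2:
  assumes "tot 2 \<phi>" "tot a \<kappa>" "tot a \<mu>"
  shows "tot a (\<lambda>p xs. \<phi> p [\<kappa> p xs, \<mu> p xs])"
  by (rule tot_comp[OF assms(1)])
    (auto simp: less_Suc_eq numeral_2_eq_2 nth_Cons' intro: assms)

text \<open>For the guard in the \<open>Comp\<close> clause of \<open>run\<close>. The list is
  fixed, so the test unfolds into finitely many nested tests.\<close>

lemma tot_if_Ex_zero:
  assumes "\<And>i. i < length \<kappa>s \<Longrightarrow> tot a (\<kappa>s ! i)" "tot a \<phi>" "tot a \<psi>"
  shows "tot a (\<lambda>p xs. if \<exists>\<kappa> \<in> set \<kappa>s. \<kappa> p xs = 0 then \<phi> p xs else \<psi> p xs)"
  using assms(1)
proof (induction \<kappa>s)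
  case Nil
  then show ?case using assms(3) by simp
next
  case (Cons \<kappa> \<kappa>s)
  have "tot a \<kappa>" using Cons.prems[of 0] by simp
  moreover have "tot a (\<lambda>p xs. if \<exists>\<kappa> \<in> set \<kappa>s. \<kappa> p xs = 0 then \<phi> p xs else \<psi> p xs)"
    using Cons.prems[of "Suc _"] by (intro Cons.IH) auto
  ultimately have "tot a (\<lambda>p xs. if \<kappa> p xs = 0 then \<phi> p xs else
      (if \<exists>\<kappa> \<in> set \<kappa>s. \<kappa> p xs = 0 then \<phi> p xs else \<psi> p xs))"
    using assms(2) by (intro tot_if_zero)
  then show ?case by (rule tot_cong) auto
qed

end

section \<open>Recursive functionals\<close>

definition rec_tot :: "nat \<Rightarrow> (baire \<Rightarrow> nat list \<Rightarrow> nat) \<Rightarrow> bool" where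
  "rec_tot a \<phi> \<longleftrightarrow> (\<exists>e. \<forall>p xs. length xs = a \<longrightarrow> eval p e xs (\<phi> p xs))"

lemma rec_tot_comp:
  assumes "rec_tot b \<phi>" "\<And>p xs. length xs = a \<Longrightarrow> length (\<psi> p xs) = b"
    and "\<And>i. i < b \<Longrightarrow> rec_tot a (\<lambda>p xs. \<psi> p xs ! i)"
  shows "rec_tot a (\<lambda>p xs. \<phi> p (\<psi> p xs))"
proof -
  obtain e where e: "\<And>p xs. length xs = b \<Longrightarrow> eval p e xs (\<phi> p xs)"
    using assms(1) unfolding rec_tot_def by blast
  have "\<forall>i. \<exists>d. i < b \<longrightarrow> (\<forall>p xs. length xs = a \<longrightarrow> eval p d xs (\<psi> p xs ! i))"
    using assms(3) unfolding rec_tot_def by blast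
  then obtain d where d: "\<And>i p xs. i < b \<Longrightarrow> length xs = a \<Longrightarrow> eval p (d i) xs (\<psi> p xs ! i)"
    by metis
  have "eval p (Comp e (map d [0..<b])) xs (\<phi> p (\<psi> p xs))" if "length xs = a" for p xs
    using assms(2) that by (intro eval.comp[where ys = "\<psi> p xs"] e)
      (auto simp: list_all2_conv_all_nth intro: d)
  then show ?thesis unfolding rec_tot_def by blast
qed

interpretation rec: primrec_class rec_tot
proof
  fix a b and \<phi> \<psi> :: "baire \<Rightarrow> nat list \<Rightarrow> nat" and \<rho> :: "baire \<Rightarrow> nat list \<Rightarrow> nat list" and i :: nat
  show "rec_tot a \<phi> \<Longrightarrow> (\<And>p xs. length xs = a \<Longrightarrow> \<phi> p xs = \<psi> p xs) \<Longrightarrow> rec_tot a \<psi>"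
    unfolding rec_tot_def by metis
  show "rec_tot a (\<lambda>p xs. 0)"
    unfolding rec_tot_def using eval.zero by blast
  show "i < a \<Longrightarrow> rec_tot a (\<lambda>p xs. xs ! i)"
    unfolding rec_tot_def using eval.proj by blast
  show "rec_tot a (\<lambda>p xs. \<phi> p (\<rho> p xs))" if "rec_tot b \<phi>"
    "\<And>p xs. length xs = a \<Longrightarrow> length (\<rho> p xs) = b" "\<And>i. i < b \<Longrightarrow> rec_tot a (\<lambda>p xs. \<rho> p xs ! i)"
    using that by (rule rec_tot_comp)
  show "rec_tot a (\<lambda>p xs. Suc (\<phi> p xs))" if "rec_tot a \<phi>"
  proof -
    have "eval p Succ xs (Suc (hd xs))" if "length xs = 1" for p xs
      using that by (cases xs) (auto intro: eval.succ)
    then have "rec_tot 1 (\<lambda>p xs. Suc (hd xs))" unfolding rec_tot_def by blast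
    from rec_tot_comp[OF this, where \<psi> = "\<lambda>p xs. [\<phi> p xs]"] that show ?thesis by simp
  qed
  show "rec_tot a (\<lambda>p xs. p (\<phi> p xs))" if "rec_tot a \<phi>"
  proof -
    have "eval p Query xs (p (hd xs))" if "length xs = 1" for p xs
      using that by (cases xs) (auto intro: eval.query)
    then have "rec_tot 1 (\<lambda>p xs. p (hd xs))" unfolding rec_tot_def by blast
    from rec_tot_comp[OF this, where \<psi> = "\<lambda>p xs. [\<phi> p xs]"] that show ?thesis by simp
  qed
  assume "rec_tot a \<phi>" "rec_tot (Suc (Suc a)) \<psi>"
  then obtain d e where d: "\<And>p xs. length xs = a \<Longrightarrow> eval p d xs (\<phi> p xs)"
    and e: "\<And>p xs. length xs = Suc (Suc a) \<Longrightarrow> eval p e xs (\<psi> p xs)"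
    unfolding rec_tot_def by blast
  have "eval p (PrimRec d e) (n # xs) (rec_nat (\<phi> p xs) (\<lambda>m y. \<psi> p (m # y # xs)) n)"
    if "length xs = a" for p n xs
    using that
  proof (induction n)
    case (Suc n)
    then show ?case using eval.primrec_Suc[OF Suc.IH e] by simp
  qed (auto intro: eval.primrec_0 d)
  then have "eval p (PrimRec d e) xs
      (rec_nat (\<phi> p (tl xs)) (\<lambda>m y. \<psi> p (m # y # tl xs)) (hd xs))" if "length xs = Suc a" for p xs
    using that by (cases xs) auto
  then show "rec_tot (Suc a) (\<lambda>p xs. rec_nat (\<phi> p (tl xs)) (\<lambda>m y. \<psi> p (m # y # tl xs)) (hd xs))"
    unfolding rec_tot_def by blast
qed

text \<open>
  Evaluation with fuel \<open>t\<close> and an approximate oracle \<open>Q\<close>: results and oracle answers are \<open>0\<close> for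
  ``unknown so far'' and \<open>Suc v\<close> for the value \<open>v\<close>. The search state in the case of \<open>Mu\<close> is
  \<open>0\<close> when stuck, \<open>1\<close> when still searching and \<open>m + 2\<close> when \<open>m\<close> was found.
\<close>

fun run :: "(nat \<Rightarrow> nat) \<Rightarrow> nat \<Rightarrow> recf \<Rightarrow> nat list \<Rightarrow> nat" where
  "run Q t Zero xs = 1"
| "run Q t Succ xs = (if length xs = 1 then Suc (Suc (xs ! 0)) else 0)"
| "run Q t (Proj i) xs = (if i < length xs then Suc (xs ! i) else 0)"
| "run Q t Query xs = (if length xs = 1 then Q (xs ! 0) else 0)"
| "run Q t (Comp f gs) xs =
    (if \<exists>g \<in> set gs. run Q t g xs = 0 then 0 else run Q t f (map (\<lambda>g. run Q t g xs - 1) gs))"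
| "run Q t (PrimRec f g) xs = (case xs of [] \<Rightarrow> 0 | n # zs \<Rightarrow>
    rec_nat (run Q t f zs) (\<lambda>m y. if y = 0 then 0 else run Q t g (m # (y - 1) # zs)) n)"
| "run Q t (Mu f) xs = rec_nat 1 (\<lambda>m s. if s = 1 then
      (if run Q t f (m # xs) = 0 then 0 else if run Q t f (m # xs) = 1 then Suc (Suc m) else 1)
    else s) t - 1"

text \<open>A nonzero result never rests on an unknown: unknown oracle answers and subresults make
  the result unknown, and a search gets stuck at an unknown candidate. No bound on \<open>t\<close>
  is therefore needed.\<close>

lemma run_sound:
  assumes "\<And>x v. Q x = Suc v \<Longrightarrow> r x = v"
  shows "run Q t e xs = Suc v \<Longrightarrow> eval r e xs v"
proof (induction e arbitrary: xs v)
  case Zero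
  then show ?case by (auto intro: eval.zero)
next
  case Succ
  then show ?case by (cases xs) (auto intro: eval.succ split: if_splits)
next
  case (Proj i)
  then show ?case by (auto intro: eval.proj split: if_splits)
next
  case Query
  then show ?case using assms by (cases xs) (auto intro: eval.query split: if_splits)
next
  case (Comp f gs)
  have "run Q t g xs = Suc (run Q t g xs - 1)" if "g \<in> set gs" for g
    using Comp.prems that by (auto split: if_splits)
  then have "list_all2 (\<lambda>g y. eval r g xs y) gs (map (\<lambda>g. run Q t g xs - 1) gs)"
    using Comp.IH(2) by (auto simp: list_all2_conv_all_nth)
  moreover have "run Q t f (map (\<lambda>g. run Q t g xs - 1) gs) = Suc v"
    using Comp.prems by (auto split: if_splits)
  ultimately show ?case using Comp.IH(1) eval.comp by blast
next
  case (PrimRec f g)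
  then obtain n zs where xs: "xs = n # zs" by (cases xs) auto
  have "rec_nat (run Q t f zs) (\<lambda>m y. if y = 0 then 0 else run Q t g (m # (y - 1) # zs)) n = Suc v
      \<Longrightarrow> eval r (PrimRec f g) (n # zs) v" for v
  proof (induction n arbitrary: v)
    case 0
    then show ?case using PrimRec.IH(1) by (auto intro: eval.primrec_0)
  next
    case (Suc n)
    then obtain y where
      y: "rec_nat (run Q t f zs) (\<lambda>m y. if y = 0 then 0 else run Q t g (m # (y - 1) # zs)) n = Suc y"
      by (cases "rec_nat (run Q t f zs)
        (\<lambda>m y. if y = 0 then 0 else run Q t g (m # (y - 1) # zs)) n") auto
    with Suc.prems have "run Q t g (n # y # zs) = Suc v" by simp
    then show ?case using Suc.IH[OF y] PrimRec.IH(2) eval.primrec_Suc by blast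
  qed
  then show ?case using PrimRec.prems xs by simp
next
  case (Mu f)
  \<comment> \<open>\<open>s k\<close> is the search state after the candidates below
    \<open>k\<close>. The final \<open>- 1\<close> in \<open>run\<close> sends both stuck and still
    searching to \<open>0\<close>, and a hit \<open>m + 2\<close> to \<open>Suc m\<close>.\<close>
  define s where "s = rec_nat 1 (\<lambda>m s. if s = 1 then
      (if run Q t f (m # xs) = 0 then 0 else if run Q t f (m # xs) = 1 then Suc (Suc m) else 1)
    else s)"
  have s_Suc: "s (Suc k) = (if s k = 1 then
      (if run Q t f (k # xs) = 0 then 0 else if run Q t f (k # xs) = 1 then Suc (Suc k) else 1)
    else s k)" and s_0: "s 0 = 1" for k by (simp_all add: s_def)
  have searching: "s k = 1 \<Longrightarrow> \<forall>m<k. \<exists>y. eval r f (m # xs) (Suc y)" for k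
  proof (induction k)
    case (Suc k)
    have "s k = 1 \<and> (\<exists>y. run Q t f (k # xs) = Suc (Suc y))"
    proof (cases "s k = 1")
      case True
      then show ?thesis using Suc.prems
        by (cases "run Q t f (k # xs)"; cases "run Q t f (k # xs) - 1") (simp_all add: s_Suc)
    next
      case False
      then show ?thesis using Suc.prems by (simp add: s_Suc)
    qed
    then obtain y where "s k = 1" "run Q t f (k # xs) = Suc (Suc y)" by blast
    then have "eval r f (k # xs) (Suc y)" using Mu.IH by blast
    then show ?case using Suc.IH[OF \<open>s k = 1\<close>] less_Suc_eq by blast
  qed simp
  have "s k = Suc (Suc v) \<Longrightarrow> eval r (Mu f) xs v" for k
  proof (induction k)
    case 0
    then show ?case by (simp add: s_0)
  next
    case (Suc k)
    show ?case
    proof (cases "s k = 1")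
      case True
      then have "v = k" "run Q t f (k # xs) = Suc 0"
        using Suc.prems by (auto simp: s_Suc split: if_splits)
      then show ?thesis using searching[OF True] Mu.IH by (auto intro: eval.mu)
    next
      case False
      then show ?thesis using Suc by (simp add: s_Suc)
    qed
  qed
  moreover have "s t = Suc (Suc v)" using Mu.prems by (simp add: s_def)
  ultimately show ?case by blast
qed

text \<open>A converging evaluation uses finitely many oracle values and search candidates, and all
  of them are eventually available. Working with "eventually" avoids any monotonicity of
  \<open>Q\<close> or \<open>run\<close> in the stage.\<close>

lemma run_complete:
  assumes "\<And>x. \<forall>\<^sub>F t in sequentially. Q t x = Suc (r x)"
  shows "eval r e xs v \<Longrightarrow> \<forall>\<^sub>F t in sequentially. run (Q t) t e xs = Suc v"
proof (induction rule: eval.induct)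
  case (query x)
  then show ?case using assms by simp
next
  case (comp xs gs ys f z)
  have len: "length gs = length ys" using comp.IH(1) by (simp add: list_all2_lengthD)
  have "\<forall>\<^sub>F t in sequentially. \<forall>i \<in> {..<length gs}. run (Q t) t (gs ! i) xs = Suc (ys ! i)"
    using comp.IH(1) by (intro eventually_ball_finite) (auto simp: list_all2_conv_all_nth)
  then show ?case using comp.IH(2)
  proof eventually_elim
    case (elim t)
    have "map (\<lambda>g. run (Q t) t g xs - 1) gs = ys"
      using elim(1) len by (intro nth_equalityI) auto
    moreover have "\<not> (\<exists>g \<in> set gs. run (Q t) t g xs = 0)"
      using elim(1) by (auto simp: in_set_conv_nth)
    ultimately show ?case using elim(2) by simp
  qed
next
  case (primrec_0 f xs z g)
  then show ?case by simp
next
  case (primrec_Suc f g n xs y z)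
  from primrec_Suc.IH show ?case by eventually_elim simp
next
  case (mu f n xs)
  have "\<forall>\<^sub>F t in sequentially. \<forall>m \<in> {..<n}. run (Q t) t f (m # xs) \<notin> {0, 1}"
  proof (intro eventually_ball_finite ballI)
    fix m assume "m \<in> {..<n}"
    then obtain y where "\<forall>\<^sub>F t in sequentially. run (Q t) t f (m # xs) = Suc (Suc y)"
      using mu.IH by auto
    then show "\<forall>\<^sub>F t in sequentially. run (Q t) t f (m # xs) \<notin> {0, 1}"
      by eventually_elim simp
  qed simp
  \<comment> \<open>Fuel \<open>t\<close> tests the candidates below \<open>t\<close> only, so
    \<open>n\<close> is reached once \<open>t > n\<close>; the state of a hit is then kept.\<close>
  then show ?case using mu.IH(1) eventually_gt_at_top[of n]
  proof eventually_elim
    case (elim t)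
    define s where "s = rec_nat 1 (\<lambda>m s. if s = 1 then
        (if run (Q t) t f (m # xs) = 0 then 0
         else if run (Q t) t f (m # xs) = 1 then Suc (Suc m) else 1)
      else s)"
    have s_Suc: "s (Suc k) = (if s k = 1 then
        (if run (Q t) t f (k # xs) = 0 then 0
         else if run (Q t) t f (k # xs) = 1 then Suc (Suc k) else 1)
      else s k)" and s_0: "s 0 = 1" for k by (simp_all add: s_def)
    have "k \<le> n \<Longrightarrow> s k = 1" for k
      using elim(1) by (induction k) (auto simp: s_0 s_Suc)
    then have "s (Suc n) = Suc (Suc n)" using elim(2) by (simp add: s_Suc)
    then have "s (Suc n + k) = Suc (Suc n)" for k
      by (induction k) (auto simp: s_Suc)
    then have "s t = Suc (Suc n)" using elim(3) by (metis Suc_leI le_add_diff_inverse)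
    then show ?case by (simp add: s_def)
  qed
qed simp_all

text \<open>The list holds the stage (also used as fuel), the index of the oracle, and then the
  arguments of \<open>e\<close>. The recursion over the syntax of \<open>e\<close> happens outside
  of the class: each fixed \<open>e\<close> yields one primitive recursive functional, and no
  universal one is required.\<close>

lemma rec_tot_run:
  assumes Q: "rec_tot 3 Q"
  shows "rec_tot (Suc (Suc a)) (\<lambda>p ys. run (\<lambda>x. Q p [ys ! 0, ys ! 1, x]) (ys ! 0) e (drop 2 ys))"
proof (induction e arbitrary: a)
  case Zero
  then show ?case by (simp add: rec.tot_const)
next
  case Succ
  have "rec_tot (Suc (Suc a)) (\<lambda>p ys. if a = 1 then Suc (Suc (drop 2 ys ! 0)) else 0)"
    by (cases "a = 1") (auto intro!: rec.tot_Suc rec.tot_drop_nth rec.tot_zero)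
  then show ?case by (rule rec.tot_cong) simp
next
  case (Proj i)
  have "rec_tot (Suc (Suc a)) (\<lambda>p ys. if i < a then Suc (drop 2 ys ! i) else 0)"
    by (cases "i < a") (auto intro!: rec.tot_Suc rec.tot_drop_nth rec.tot_zero)
  then show ?case by (rule rec.tot_cong) simp
next
  case Query
  have "rec_tot (Suc (Suc a)) (\<lambda>p ys. if a = 1 then Q p [ys ! 0, ys ! 1, drop 2 ys ! 0] else 0)"
  proof (cases "a = 1")
    case True
    then show ?thesis
      by (simp only: refl if_True) (intro rec.tot_app3[OF Q] rec.tot_nth rec.tot_drop_nth; simp)
  qed (simp add: rec.tot_zero)
  then show ?case by (rule rec.tot_cong) simp
next
  case (Comp f gs)
  define G where "G g p ys = run (\<lambda>x. Q p [ys ! 0, ys ! 1, x]) (ys ! 0) g (drop 2 ys)" for g p ys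
  \<comment> \<open>Stage and index are put back in front of the computed arguments, as the
    induction hypothesis for \<open>f\<close> expects.\<close>
  define Y where "Y p ys = ys ! 0 # ys ! 1 # map (\<lambda>g. G g p ys - 1) gs" for p ys
  have f: "rec_tot (Suc (Suc (length gs))) (G f)"
    using Comp.IH(1) unfolding G_def .
  have G: "rec_tot (Suc (Suc a)) (G g)" if "g \<in> set gs" for g
    using Comp.IH(2)[OF that] unfolding G_def .
  have "rec_tot (Suc (Suc a)) (\<lambda>p ys. Y p ys ! i)" if i: "i < Suc (Suc (length gs))" for i
  proof -
    consider "i = 0" | "i = 1" | j where "i = Suc (Suc j)" "j < length gs"
      using i by (cases i; cases "i - 1") auto
    then show ?thesis
    proof cases
      case 3
      then have "rec_tot (Suc (Suc a)) (\<lambda>p ys. G (gs ! j) p ys - 1)"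
        by (intro rec.tot_pred G) simp
      then show ?thesis using 3 by (simp add: Y_def)
    qed (simp_all add: Y_def rec.tot_nth)
  qed
  then have "rec_tot (Suc (Suc a)) (\<lambda>p ys. G f p (Y p ys))"
    by (intro rec.tot_comp[OF f]) (simp_all add: Y_def)
  then have "rec_tot (Suc (Suc a)) (\<lambda>p ys. if \<exists>\<kappa> \<in> set (map G gs). \<kappa> p ys = 0 then 0 else
      G f p (Y p ys))"
    by (intro rec.tot_if_Ex_zero rec.tot_zero) (simp_all add: G)
  then show ?case by (rule rec.tot_cong) (auto simp: G_def Y_def)
next
  case (PrimRec f g)
  show ?case
  proof (cases a)
    case 0
    show ?thesis by (rule rec.tot_cong[OF rec.tot_zero]) (simp add: 0)
  next
    case (Suc b)
    define F where "F e p ys = run (\<lambda>x. Q p [ys ! 0, ys ! 1, x]) (ys ! 0) e (drop 2 ys)" for e p ys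
    have f: "rec_tot (Suc (Suc b)) (F f)" and g: "rec_tot (Suc (Suc (Suc (Suc b)))) (F g)"
      using PrimRec.IH unfolding F_def .
    have "rec_tot (Suc (Suc a)) (\<lambda>p ys. rec_nat (F f p (ys ! 0 # ys ! 1 # drop 3 ys))
      (\<lambda>m y. if y = 0 then 0 else F g p (ys ! 0 # ys ! 1 # m # (y - 1) # drop 3 ys)) (ys ! 2))"
    proof (intro rec.tot_rec_nat rec.tot_if_zero rec.tot_zero rec.tot_nth)
      show "rec_tot (Suc (Suc a)) (\<lambda>p ys. F f p (ys ! 0 # ys ! 1 # drop 3 ys))"
        by (rule rec.tot_comp[OF f]) (auto simp: Suc less_Suc_eq_0_disj
          intro!: rec.tot_nth rec.tot_drop_nth)
      show "rec_tot (Suc (Suc (Suc (Suc a)))) (\<lambda>p zs. F g p (drop 2 zs ! 0 # drop 2 zs ! 1 #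
          zs ! 0 # (zs ! 1 - 1) # drop 3 (drop 2 zs)))"
        by (rule rec.tot_comp[OF g]) (auto simp: Suc less_Suc_eq_0_disj
          intro!: rec.tot_nth rec.tot_drop_nth rec.tot_pred[unfolded One_nat_def])
    qed (auto simp: Suc)
    then show ?thesis
    proof (rule rec.tot_cong)
      fix p and ys :: "nat list" assume "length ys = Suc (Suc a)"
      then obtain t n m zs where "ys = t # n # m # zs"
        by (auto simp: Suc length_Suc_conv)
      then show "rec_nat (F f p (ys ! 0 # ys ! 1 # drop 3 ys))
          (\<lambda>m y. if y = 0 then 0 else F g p (ys ! 0 # ys ! 1 # m # (y - 1) # drop 3 ys)) (ys ! 2)
        = run (\<lambda>x. Q p [ys ! 0, ys ! 1, x]) (ys ! 0) (PrimRec f g) (drop 2 ys)"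
        by (simp add: F_def numeral_3_eq_3 numeral_2_eq_2 cong: if_cong)
    qed
  qed
next
  case (Mu f)
  define F where "F p ys = run (\<lambda>x. Q p [ys ! 0, ys ! 1, x]) (ys ! 0) f (drop 2 ys)" for p ys
  have f: "rec_tot (Suc (Suc (Suc a))) F" using Mu.IH unfolding F_def .
  have F: "rec_tot (Suc (Suc (Suc (Suc a))))
      (\<lambda>p zs. F p (drop 2 zs ! 0 # drop 2 zs ! 1 # zs ! 0 # drop 2 (drop 2 zs)))"
    by (rule rec.tot_comp[OF f]) (auto simp: less_Suc_eq_0_disj
        intro!: rec.tot_nth rec.tot_drop_nth)
  have "rec_tot (Suc (Suc a)) (\<lambda>p ys. rec_nat 1 (\<lambda>m s. if s = 1 then
      (if F p (ys ! 0 # ys ! 1 # m # drop 2 ys) = 0 then 0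
       else if F p (ys ! 0 # ys ! 1 # m # drop 2 ys) = 1 then Suc (Suc m) else 1)
    else s) (ys ! 0) - 1)"
    by (intro rec.tot_pred rec.tot_rec_nat rec.tot_if_eq rec.tot_const rec.tot_nth rec.tot_Suc F)
      auto
  then show ?case by (rule rec.tot_cong) (simp add: F_def cong: if_cong)
qed

section \<open>Continuous functionals\<close>

text \<open>Local constancy is continuity into the discrete naturals, here for each argument list
  separately.\<close>

definition cont_tot :: "nat \<Rightarrow> (baire \<Rightarrow> nat list \<Rightarrow> nat) \<Rightarrow> bool" where
  "cont_tot a \<phi> \<longleftrightarrow> (\<forall>p xs. length xs = a \<longrightarrow> (\<forall>\<^sub>F p' in nhds p. \<phi> p' xs = \<phi> p xs))"

text \<open>A basic open set of the product restricts finitely many coordinates, all below some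
  \<open>N\<close>; conversely a cylinder is open.\<close>

lemma eventually_nhds_baire:
  fixes p :: baire
  shows "eventually P (nhds p) \<longleftrightarrow> (\<exists>N. \<forall>p'. (\<forall>x<N. p' x = p x) \<longrightarrow> P p')"
proof
  assume "eventually P (nhds p)"
  then obtain S where S: "open S" "p \<in> S" "\<forall>p'\<in>S. P p'"
    by (auto simp: eventually_nhds)
  then obtain X where X: "p \<in> Pi\<^sub>E UNIV X" "finite {i. X i \<noteq> UNIV}" "Pi\<^sub>E UNIV X \<subseteq> S"
    using product_topology_open_contains_basis[of "\<lambda>_. euclidean" UNIV S p]
    by (auto simp: open_fun_def)
  obtain N where N: "\<forall>i\<in>{i. X i \<noteq> UNIV}. i < N"
    using X(2) finite_nat_set_iff_bounded by blast
  have "P p'" if "\<forall>x<N. p' x = p x" for p'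
  proof -
    have "p' i \<in> X i" for i
      using X(1) N that by (cases "X i = UNIV") (auto simp: PiE_iff)
    then show ?thesis using X(3) S(3) by blast
  qed
  then show "\<exists>N. \<forall>p'. (\<forall>x<N. p' x = p x) \<longrightarrow> P p'" by blast
next
  assume "\<exists>N. \<forall>p'. (\<forall>x<N. p' x = p x) \<longrightarrow> P p'"
  then obtain N where N: "\<And>p'. (\<forall>x<N. p' x = p x) \<Longrightarrow> P p'" by blast
  define S where "S = {p'. \<forall>i\<in>{..<N}. p' i \<in> {p i}}"
  have "open S"
    unfolding S_def by (intro product_topology_basis') (auto intro: open_discrete)
  then show "eventually P (nhds p)"
    unfolding eventually_nhds by (intro exI[of _ S]) (auto simp: S_def intro: N)
qed

text \<open>Continuity into a product is coordinatewise, and convergence in a discrete space is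
  eventual equality. Points outside the domain satisfy the condition vacuously, so punctured limits
  within \<open>dom F\<close> become plain neighbourhood statements.\<close>

lemma continuous_partial_iff:
  "continuous_partial F \<longleftrightarrow>
    (\<forall>p q k. F p = Some q \<longrightarrow> (\<forall>\<^sub>F p' in nhds p. \<forall>q'. F p' = Some q' \<longrightarrow> q' k = q k))"
proof -
  have lim: "((\<lambda>p. the (F p) k) \<longlongrightarrow> the (F p) k) (at p within dom F) \<longleftrightarrow>
      (\<forall>\<^sub>F p' in nhds p. \<forall>q'. F p' = Some q' \<longrightarrow> q' k = q k)" if "F p = Some q" for p q k
  proof -
    have "(p' \<noteq> p \<longrightarrow> p' \<in> dom F \<longrightarrow> the (F p') k = the (F p) k) \<longleftrightarrow>
        (\<forall>q'. F p' = Some q' \<longrightarrow> q' k = q k)" for p'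
      using that by (cases "F p'") auto
    then show ?thesis
      by (simp add: tendsto_discrete eventually_at_filter)
  qed
  have "continuous_partial F \<longleftrightarrow>
      (\<forall>k. \<forall>p\<in>dom F. ((\<lambda>p. the (F p) k) \<longlongrightarrow> the (F p) k) (at p within dom F))"
    unfolding continuous_partial_def continuous_on_def [symmetric]
    by (rule iffI, rule allI, erule continuous_on_product_then_coordinatewise,
        rule continuous_on_coordinatewise_then_product, erule spec)
  moreover have "\<dots> \<longleftrightarrow>
      (\<forall>p q k. F p = Some q \<longrightarrow> (\<forall>\<^sub>F p' in nhds p. \<forall>q'. F p' = Some q' \<longrightarrow> q' k = q k))"
    (is "?L \<longleftrightarrow> ?R")
  proof
    show ?R if ?L
    proof (intro allI impI)
      fix p q k assume q: "F p = Some q"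
      then have "((\<lambda>p. the (F p) k) \<longlongrightarrow> the (F p) k) (at p within dom F)"
        using that by blast
      then show "\<forall>\<^sub>F p' in nhds p. \<forall>q'. F p' = Some q' \<longrightarrow> q' k = q k"
        unfolding lim[OF q] .
    qed
    show ?L if ?R
    proof (intro allI ballI)
      fix k p assume "p \<in> dom F"
      then obtain q where q: "F p = Some q" by blast
      then show "((\<lambda>p. the (F p) k) \<longlongrightarrow> the (F p) k) (at p within dom F)"
        using that unfolding lim[OF q] by blast
    qed
  qed
  ultimately show ?thesis by simp
qed

interpretation cont: primrec_class cont_tot
proof
  fix a b and \<phi> \<psi> :: "baire \<Rightarrow> nat list \<Rightarrow> nat" and \<rho> :: "baire \<Rightarrow> nat list \<Rightarrow> nat list" and i :: nat
  show "cont_tot a \<phi> \<Longrightarrow> (\<And>p xs. length xs = a \<Longrightarrow> \<phi> p xs = \<psi> p xs) \<Longrightarrow> cont_tot a \<psi>"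
    unfolding cont_tot_def by simp
  show "cont_tot a (\<lambda>p xs. 0)" and "i < a \<Longrightarrow> cont_tot a (\<lambda>p xs. xs ! i)"
    unfolding cont_tot_def by simp_all
  show "cont_tot a (\<lambda>p xs. Suc (\<phi> p xs))" if "cont_tot a \<phi>"
    using that unfolding cont_tot_def by simp
  show "cont_tot a (\<lambda>p xs. p (\<phi> p xs))" if "cont_tot a \<phi>"
    unfolding cont_tot_def
  proof (intro allI impI)
    fix p :: baire and xs :: "nat list" assume "length xs = a"
    then have "\<forall>\<^sub>F p' in nhds p. \<phi> p' xs = \<phi> p xs" using that by (auto simp: cont_tot_def)
    moreover have "\<forall>\<^sub>F p' in nhds p. p' (\<phi> p xs) = p (\<phi> p xs)"
      by (auto simp: eventually_nhds_baire intro: exI[of _ "Suc (\<phi> p xs)"])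
    ultimately show "\<forall>\<^sub>F p' in nhds p. p' (\<phi> p' xs) = p (\<phi> p xs)"
      by eventually_elim simp
  qed
  show "cont_tot a (\<lambda>p xs. \<phi> p (\<rho> p xs))" if \<phi>: "cont_tot b \<phi>"
    and len: "\<And>p xs. length xs = a \<Longrightarrow> length (\<rho> p xs) = b"
    and \<rho>: "\<And>i. i < b \<Longrightarrow> cont_tot a (\<lambda>p xs. \<rho> p xs ! i)"
    unfolding cont_tot_def
  proof (intro allI impI)
    fix p :: baire and xs :: "nat list" assume xs: "length xs = a"
    then have "\<forall>\<^sub>F p' in nhds p. \<forall>i\<in>{..<b}. \<rho> p' xs ! i = \<rho> p xs ! i"
      using \<rho> by (intro eventually_ball_finite) (auto simp: cont_tot_def)
    moreover have "\<forall>\<^sub>F p' in nhds p. \<phi> p' (\<rho> p xs) = \<phi> p (\<rho> p xs)"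
      using \<phi> len xs by (auto simp: cont_tot_def)
    ultimately show "\<forall>\<^sub>F p' in nhds p. \<phi> p' (\<rho> p' xs) = \<phi> p (\<rho> p xs)"
    proof eventually_elim
      case (elim p')
      then have "\<rho> p' xs = \<rho> p xs" using len xs by (intro nth_equalityI) auto
      then show ?case using elim by simp
    qed
  qed
  assume \<phi>: "cont_tot a \<phi>" and \<psi>: "cont_tot (Suc (Suc a)) \<psi>"
  show "cont_tot (Suc a) (\<lambda>p xs. rec_nat (\<phi> p (tl xs)) (\<lambda>m y. \<psi> p (m # y # tl xs)) (hd xs))"
    unfolding cont_tot_def
  proof (intro allI impI)
    fix p :: baire and xs :: "nat list" assume "length xs = Suc a"
    then have tl: "length (tl xs) = a" by simp
    show "\<forall>\<^sub>F p' in nhds p. rec_nat (\<phi> p' (tl xs)) (\<lambda>m y. \<psi> p' (m # y # tl xs)) (hd xs)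
      = rec_nat (\<phi> p (tl xs)) (\<lambda>m y. \<psi> p (m # y # tl xs)) (hd xs)"
    \<comment> \<open>The recursion depth does not depend on \<open>p'\<close>, so it is generalised
      to make induction on it possible.\<close>
    proof (rule spec[of _ "hd xs"], rule allI)
      fix n
      show "\<forall>\<^sub>F p' in nhds p. rec_nat (\<phi> p' (tl xs)) (\<lambda>m y. \<psi> p' (m # y # tl xs)) n
        = rec_nat (\<phi> p (tl xs)) (\<lambda>m y. \<psi> p (m # y # tl xs)) n"
      proof (induction n)
        case 0
        then show ?case using \<phi> tl by (simp add: cont_tot_def)
      next
        case (Suc n)
        have "\<forall>\<^sub>F p' in nhds p. \<psi> p' (n # y # tl xs) = \<psi> p (n # y # tl xs)" for y
          using \<psi> tl by (simp add: cont_tot_def)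
        \<comment> \<open>Near \<open>p\<close> the previous value equals the one computed from
          \<open>p\<close>, so local constancy of \<open>\<psi>\<close> is needed at this value
          only.\<close>
        from Suc.IH this[of "rec_nat (\<phi> p (tl xs)) (\<lambda>m y. \<psi> p (m # y # tl xs)) n"]
        show ?case by eventually_elim simp
      qed
    qed
  qed
qed


section \<open>Effective partial functions on Baire space\<close>

text \<open>As for \<open>run\<close>, \<open>Q t x = 0\<close> means that the value at \<open>x\<close> is not known at stage \<open>t\<close>.\<close>

definition approximates :: "(nat \<Rightarrow> nat \<Rightarrow> nat) \<Rightarrow> baire \<Rightarrow> bool" where
  "approximates Q r \<longleftrightarrow>
    (\<forall>x. (\<forall>t. Q t x \<noteq> 0 \<longrightarrow> Q t x = Suc (r x)) \<and> (\<forall>\<^sub>F t in sequentially. Q t x = Suc (r x)))"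

text \<open>The two axioms lead out of and into the stagewise form. The extra index \<open>n\<close>
  allows \<open>F\<close> to be applied to a whole sequence of arguments by one functional;
  correctness is asked only for \<open>r\<close> in the domain of \<open>F\<close>.\<close>

locale effective_class = primrec_class tot
  for tot :: "nat \<Rightarrow> (baire \<Rightarrow> nat list \<Rightarrow> nat) \<Rightarrow> bool" +
  fixes eff :: "(baire \<rightharpoonup> baire) \<Rightarrow> bool"
  assumes eff_search: "tot 2 \<phi> \<Longrightarrow> (\<And>p q k. F p = Some q \<Longrightarrow> \<exists>t. \<phi> p [t, k] \<noteq> 0)
      \<Longrightarrow> (\<And>p q k t. F p = Some q \<Longrightarrow> \<phi> p [t, k] \<noteq> 0 \<Longrightarrow> \<phi> p [t, k] = Suc (q k)) \<Longrightarrow> eff F"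
    and eff_approximates: "eff F \<Longrightarrow> tot 3 Q \<Longrightarrow> \<exists>R. tot 3 R \<and>
      (\<forall>p n r s. approximates (\<lambda>t x. Q p [t, n, x]) r \<and> F r = Some s
        \<longrightarrow> approximates (\<lambda>t x. R p [t, n, x]) s)"

interpretation rec: effective_class rec_tot computable
proof
  fix \<phi> :: "baire \<Rightarrow> nat list \<Rightarrow> nat" and F :: "baire \<rightharpoonup> baire"
  assume tot: "rec_tot 2 \<phi>"
    and total: "\<And>p q k. F p = Some q \<Longrightarrow> \<exists>t. \<phi> p [t, k] \<noteq> 0"
    and correct: "\<And>p q k t. F p = Some q \<Longrightarrow> \<phi> p [t, k] \<noteq> 0 \<Longrightarrow> \<phi> p [t, k] = Suc (q k)"
  \<comment> \<open>\<open>1 - \<phi>\<close> is zero exactly at the stages where the value is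
    known, which is what \<open>Mu\<close> looks for; \<open>\<phi> - 1\<close> then removes the
    \<open>Suc\<close>.\<close>
  have "rec_tot 2 (\<lambda>p xs. 1 - \<phi> p xs)" "rec_tot 2 (\<lambda>p xs. \<phi> p xs - 1)"
    by (intro rec.tot_diff rec.tot_const tot)+
  then obtain d e where d: "\<And>p xs. length xs = 2 \<Longrightarrow> eval p d xs (1 - \<phi> p xs)"
    and e: "\<And>p xs. length xs = 2 \<Longrightarrow> eval p e xs (\<phi> p xs - 1)"
    unfolding rec_tot_def by blast
  have "eval p (Comp e [Mu d, Proj 0]) [k] (q k)" if q: "F p = Some q" for p q k
  proof -
    define t where "t = (LEAST t. \<phi> p [t, k] \<noteq> 0)"
    have t: "\<phi> p [t, k] \<noteq> 0" unfolding t_def using total[OF q] by (rule LeastI_ex)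
    have "\<phi> p [m, k] = 0" if "m < t" for m
      using that not_less_Least unfolding t_def by blast
    then have "eval p d [m, k] (Suc 0)" if "m < t" for m
      using d[of "[m, k]" p] that by simp
    then have "eval p (Mu d) [k] t"
      using t d[of "[t, k]" p] by (intro eval.mu) auto
    moreover have "eval p (Proj 0) [k] k" using eval.proj[of 0 "[k]" p] by simp
    moreover have "eval p e [t, k] (q k)"
      using e[of "[t, k]" p] correct[OF q t] by simp
    ultimately show ?thesis by (intro eval.comp[where ys = "[t, k]"]) auto
  qed
  then show "computable F" unfolding computable_def by blast
next
  fix Q :: "baire \<Rightarrow> nat list \<Rightarrow> nat" and F :: "baire \<rightharpoonup> baire"
  assume "computable F" and Q: "rec_tot 3 Q"
  then obtain e where e: "\<And>p q n. F p = Some q \<Longrightarrow> eval p e [n] (q n)"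
    unfolding computable_def by blast
  define R where "R p ys = run (\<lambda>x. Q p [ys ! 0, ys ! 1, x]) (ys ! 0) e (drop 2 ys)" for p ys
  have "rec_tot 3 R"
    using rec_tot_run[OF Q, of 1 e] unfolding R_def by (simp add: numeral_3_eq_3)
  moreover have "approximates (\<lambda>t x. R p [t, n, x]) s"
    if Qr: "approximates (\<lambda>t x. Q p [t, n, x]) r" and s: "F r = Some s" for p n r s
    unfolding approximates_def
  proof (intro allI conjI impI)
    fix x t
    assume "R p [t, n, x] \<noteq> 0"
    then obtain v where v: "run (\<lambda>x. Q p [t, n, x]) t e [x] = Suc v"
      by (cases "R p [t, n, x]") (auto simp: R_def)
    have "eval r e [x] v"
    proof (rule run_sound[OF _ v])
      show "r x = v" if "Q p [t, n, x] = Suc v" for x v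
        using that Qr unfolding approximates_def by (metis nat.distinct(1) nat.inject)
    qed
    then have "v = s x" using e[OF s] by (rule eval_deterministic)
    then show "R p [t, n, x] = Suc (s x)" using v by (simp add: R_def)
  next
    fix x
    have "\<forall>\<^sub>F t in sequentially. run (\<lambda>x. Q p [t, n, x]) t e [x] = Suc (s x)"
      using Qr by (intro run_complete[OF _ e[OF s]]) (auto simp: approximates_def)
    then show "\<forall>\<^sub>F t in sequentially. R p [t, n, x] = Suc (s x)" by (simp add: R_def)
  qed
  ultimately show "\<exists>R. rec_tot 3 R \<and> (\<forall>p n r s. approximates (\<lambda>t x. Q p [t, n, x]) r \<and> F r = Some s
      \<longrightarrow> approximates (\<lambda>t x. R p [t, n, x]) s)" by blast
qed

interpretation cont: effective_class cont_tot continuous_partial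
proof
  fix \<phi> :: "baire \<Rightarrow> nat list \<Rightarrow> nat" and F :: "baire \<rightharpoonup> baire"
  assume tot: "cont_tot 2 \<phi>"
    and total: "\<And>p q k. F p = Some q \<Longrightarrow> \<exists>t. \<phi> p [t, k] \<noteq> 0"
    and correct: "\<And>p q k t. F p = Some q \<Longrightarrow> \<phi> p [t, k] \<noteq> 0 \<Longrightarrow> \<phi> p [t, k] = Suc (q k)"
  show "continuous_partial F"
    unfolding continuous_partial_iff
  proof (intro allI impI)
    fix p q k assume q: "F p = Some q"
    then obtain t where t: "\<phi> p [t, k] \<noteq> 0" using total by blast
    have "\<forall>\<^sub>F p' in nhds p. \<phi> p' [t, k] = \<phi> p [t, k]"
      using tot by (simp add: cont_tot_def)
    then show "\<forall>\<^sub>F p' in nhds p. \<forall>q'. F p' = Some q' \<longrightarrow> q' k = q k"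
      by eventually_elim (metis correct q t nat.inject)
  qed
next
  fix Q :: "baire \<Rightarrow> nat list \<Rightarrow> nat" and F :: "baire \<rightharpoonup> baire"
  assume F: "continuous_partial F" and Q: "cont_tot 3 Q"
  text \<open>
    At stage \<open>t\<close> the value at \<open>k\<close> is known if all points of the domain of \<open>F\<close> that are consistent
    with the first \<open>t\<close> answers of the oracle agree on it.
  \<close>
  define D where "D p t n = {(r, s). F r = Some s \<and>
      (\<forall>x<t. Q p [t, n, x] \<noteq> 0 \<longrightarrow> Q p [t, n, x] = Suc (r x))}" for p t n
  define known where "known p t n k v \<longleftrightarrow> D p t n \<noteq> {} \<and> (\<forall>(r, s) \<in> D p t n. s k = v)" for p t n k v
  define R where "R p ys = (if \<exists>v. known p (ys ! 0) (ys ! 1) (ys ! 2) v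
      then Suc (THE v. known p (ys ! 0) (ys ! 1) (ys ! 2) v) else 0)" for p ys
  have R: "R p [t, n, k] = Suc v" if "known p t n k v" for p t n k v
  proof -
    have "(THE v. known p t n k v) = v"
      using that by (intro the_equality) (auto simp: known_def)
    then show ?thesis using that by (auto simp: R_def)
  qed
  \<comment> \<open>Although \<open>D\<close> ranges over the whole graph of \<open>F\<close>, it
    depends on \<open>p\<close> only through finitely many values of \<open>Q\<close>, each locally
    constant in \<open>p\<close>.\<close>
  have "cont_tot 3 R"
    unfolding cont_tot_def
  proof (intro allI impI)
    fix p :: baire and ys :: "nat list"
    have "\<forall>\<^sub>F p' in nhds p. \<forall>x\<in>{..<ys ! 0}. Q p' [ys ! 0, ys ! 1, x] = Q p [ys ! 0, ys ! 1, x]"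
      using Q by (intro eventually_ball_finite) (auto simp: cont_tot_def)
    then show "\<forall>\<^sub>F p' in nhds p. R p' ys = R p ys"
    proof eventually_elim
      case (elim p')
      then have "D p' (ys ! 0) (ys ! 1) = D p (ys ! 0) (ys ! 1)" by (simp add: D_def)
      then show ?case by (simp add: R_def known_def [abs_def])
    qed
  qed
  moreover have "approximates (\<lambda>t x. R p [t, n, x]) s"
    if Qr: "approximates (\<lambda>t x. Q p [t, n, x]) r" and s: "F r = Some s" for p n r s
    unfolding approximates_def
  proof (intro allI conjI impI)
    have rs: "(r, s) \<in> D p t n" for t
      using Qr s by (simp add: D_def approximates_def)
    {
      fix t x assume "R p [t, n, x] \<noteq> 0"
      then obtain v where "known p t n x v" by (auto simp: R_def split: if_splits)
      moreover from this have "v = s x" using rs[of t] by (auto simp: known_def)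
      ultimately show "R p [t, n, x] = Suc (s x)" using R by simp
    }
    fix k
    \<comment> \<open>A modulus of continuity of \<open>F\<close> at \<open>r\<close> for the
      coordinate \<open>k\<close>: from stage \<open>N\<close> on, once the first \<open>N\<close>
      answers are known, every pair in \<open>D p t n\<close> agrees with \<open>r\<close> below
      \<open>N\<close>.\<close>
    obtain N where N: "\<And>r' s'. \<forall>x<N. r' x = r x \<Longrightarrow> F r' = Some s' \<Longrightarrow> s' k = s k"
      using F s unfolding continuous_partial_iff eventually_nhds_baire by meson
    have "\<forall>\<^sub>F t in sequentially. \<forall>x\<in>{..<N}. Q p [t, n, x] = Suc (r x)"
      using Qr by (intro eventually_ball_finite) (auto simp: approximates_def)
    then show "\<forall>\<^sub>F t in sequentially. R p [t, n, k] = Suc (s k)"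
      using eventually_ge_at_top[of N]
    proof eventually_elim
      case (elim t)
      have "s' k = s k" if "(r', s') \<in> D p t n" for r' s'
      proof (rule N[of r' s'])
        show "F r' = Some s'" using that by (simp add: D_def)
        have "Q p [t, n, x] = Suc (r x)" "Q p [t, n, x] \<noteq> 0 \<longrightarrow> Q p [t, n, x] = Suc (r' x)"
          if "x < N" for x
          using \<open>(r', s') \<in> D p t n\<close> elim that by (simp_all add: D_def)
        then show "\<forall>x<N. r' x = r x" by fastforce
      qed
      then show ?case using rs by (intro R) (auto simp: known_def)
    qed
  qed
  ultimately show "\<exists>R. cont_tot 3 R \<and> (\<forall>p n r s. approximates (\<lambda>t x. Q p [t, n, x]) r \<and> F r = Some s
      \<longrightarrow> approximates (\<lambda>t x. R p [t, n, x]) s)" by blast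
qed

section \<open>Uniformly approximable sequences of partial functions\<close>

lemma card_enumerate_below:
  fixes S :: "nat set"
  assumes "infinite S"
  shows "card {i \<in> S. i < enumerate S n} = n"
proof -
  have "{i \<in> S. i < enumerate S n} = enumerate S ` {..<n}"
  proof (intro equalityI subsetI)
    fix i assume "i \<in> {i \<in> S. i < enumerate S n}"
    then obtain m where "enumerate S m = i" "enumerate S m < enumerate S n"
      using enumerate_Ex[OF assms] by blast
    then show "i \<in> enumerate S ` {..<n}" using assms by auto
  qed (use assms in \<open>auto simp: enumerate_in_set\<close>)
  then show ?thesis
    using assms by (simp add: card_image inj_on_subset[OF inj_enumerate])
qed

lemma enumerate_card_below:
  fixes S :: "nat set"
  assumes "infinite S" "t \<in> S"
  shows "enumerate S (card {i \<in> S. i < t}) = t"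
  using assms card_enumerate_below enumerate_Ex by metis

text \<open>The place of an entry in \<open>p - 1\<close> is the number of nonzero entries before
  it. This fits streams that emit the next value, plus one, whenever they are ready.\<close>

lemma minus_one_eq:
  assumes "infinite {t. s t \<noteq> 0}"
    and "\<And>t. s t \<noteq> 0 \<Longrightarrow> s t = Suc (r (card {i. s i \<noteq> 0 \<and> i < t}))"
  shows "minus_one s = Some r"
proof -
  let ?S = "{t. s t \<noteq> 0}"
  have "s (enumerate ?S n) - 1 = r n" for n
    using assms(2)[of "enumerate ?S n"] enumerate_in_set[OF assms(1), of n]
      card_enumerate_below[OF assms(1), of n] by simp
  then show ?thesis using assms(1) by (simp add: minus_one_def Let_def)
qed

lemma card_below_Suc:
  "card {i. P i \<and> i < Suc t} = (if P t then Suc (card {i. P i \<and> i < t}) else card {i. P i \<and> i < t})"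
proof -
  have "{i. P i \<and> i < Suc t} = (if P t then insert t {i. P i \<and> i < t} else {i. P i \<and> i < t})"
    by (auto simp: less_Suc_eq)
  then show ?thesis by simp
qed

context effective_class
begin

text \<open>One \<open>Q\<close> serves all \<open>n\<close>. It is total, but unconstrained at
  those \<open>n\<close> and \<open>p\<close> where \<open>A n p\<close> is undefined.\<close>

definition approximable :: "(nat \<Rightarrow> baire \<rightharpoonup> baire) \<Rightarrow> bool" where
  "approximable A \<longleftrightarrow>
    (\<exists>Q. tot 3 Q \<and> (\<forall>n p r. A n p = Some r \<longrightarrow> approximates (\<lambda>t x. Q p [t, n, x]) r))"

lemma approximable_total:
  assumes "tot 2 (\<lambda>p xs. \<phi> p (xs ! 0) (xs ! 1))"
  shows "approximable (\<lambda>n p. Some (\<phi> p n))"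
proof -
  have "tot 3 (\<lambda>p xs. Suc (\<phi> p (xs ! 1) (xs ! 2)))"
    using tot_app2[OF assms tot_nth[of 1 3] tot_nth[of 2 3]] by (intro tot_Suc) simp
  then show ?thesis
    unfolding approximable_def
    by (intro exI[of _ "\<lambda>p xs. Suc (\<phi> p (xs ! 1) (xs ! 2))"]) (auto simp: approximates_def)
qed

lemma approximable_comp:
  assumes "eff F" "approximable A"
  shows "approximable (\<lambda>n. F \<circ>\<^sub>m A n)"
proof -
  obtain Q where Q: "tot 3 Q"
    "\<And>n p r. A n p = Some r \<Longrightarrow> approximates (\<lambda>t x. Q p [t, n, x]) r"
    using assms(2) unfolding approximable_def by blast
  obtain R where "tot 3 R" "\<And>p n r s. approximates (\<lambda>t x. Q p [t, n, x]) r \<Longrightarrow> F r = Some s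
      \<Longrightarrow> approximates (\<lambda>t x. R p [t, n, x]) s"
    using eff_approximates[OF assms(1) Q(1)] by blast
  then show ?thesis
    unfolding approximable_def map_comp_Some_iff using Q(2) by blast
qed

lemma approximable_reindex:
  assumes "approximable A" "tot 1 (\<lambda>p xs. \<iota> (xs ! 0))" "tot 2 (\<lambda>p xs. \<gamma> (xs ! 0) (xs ! 1))"
  shows "approximable (\<lambda>n p. map_option (\<lambda>r x. r (\<gamma> n x)) (A (\<iota> n) p))"
proof -
  obtain Q where Q: "tot 3 Q"
    "\<And>n p r. A n p = Some r \<Longrightarrow> approximates (\<lambda>t x. Q p [t, n, x]) r"
    using assms(1) unfolding approximable_def by blast
  define R where "R p xs = Q p [xs ! 0, \<iota> (xs ! 1), \<gamma> (xs ! 1) (xs ! 2)]" for p and xs :: "nat list"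
  have "tot 3 (\<lambda>p xs. \<iota> ([xs ! 1] ! 0))"
    by (rule tot_comp[OF assms(2)]) (auto intro: tot_nth)
  moreover have "tot 3 (\<lambda>p xs. \<gamma> ([xs ! 1, xs ! 2] ! 0) ([xs ! 1, xs ! 2] ! 1))"
    by (rule tot_app2[OF assms(3)]) (auto intro: tot_nth)
  ultimately have "tot 3 R"
    unfolding R_def by (intro tot_app3[OF Q(1)] tot_nth) simp_all
  then show ?thesis
    unfolding approximable_def
    by (intro exI[of _ R]) (auto simp: R_def approximates_def dest!: Q(2))
qed

lemma tot_component: "tot 2 (\<lambda>p xs. component (xs ! 0) p (xs ! 1))"
  unfolding component_def by (intro tot_query tot_tuple_index tot_nth) simp_all

lemma approximable_component: "approximable (\<lambda>n p. Some (component n p))"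
  using tot_component by (rule approximable_total)

lemma approximable_pair:
  assumes "approximable A" "approximable B"
  shows "approximable (\<lambda>n p. Option.bind (A n p) (\<lambda>a. map_option (pair a) (B n p)))"
proof -
  obtain Q where Q: "tot 3 Q"
    "\<And>n p r. A n p = Some r \<Longrightarrow> approximates (\<lambda>t x. Q p [t, n, x]) r"
    using assms(1) unfolding approximable_def by blast
  obtain R where R: "tot 3 R"
    "\<And>n p r. B n p = Some r \<Longrightarrow> approximates (\<lambda>t x. R p [t, n, x]) r"
    using assms(2) unfolding approximable_def by blast
  define S where "S p xs = (if xs ! 2 mod 2 = 0 then Q p [xs ! 0, xs ! 1, xs ! 2 div 2]
    else R p [xs ! 0, xs ! 1, xs ! 2 div 2])" for p xs
  have "tot 3 S"
    unfolding S_def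
    by (intro tot_if_zero tot_mod2 tot_app3[OF Q(1)] tot_app3[OF R(1)] tot_div2 tot_nth) simp_all
  moreover have "approximates (\<lambda>t x. S p [t, n, x]) (pair a b)"
    if "A n p = Some a" "B n p = Some b" for n p a b
    using Q(2)[OF that(1)] R(2)[OF that(2)]
    by (simp add: approximates_def S_def pair_def even_iff_mod_2_eq_zero)
  ultimately show ?thesis
    unfolding approximable_def by (intro exI[of _ S]) (auto simp: bind_eq_Some_conv)
qed

text \<open>The value at \<open>k\<close> is sought in the component and at the place that
  \<open>k\<close> codes. \<open>A\<close> may converge outside the domain of \<open>F\<close>, so
  that \<open>F\<close> can be a convenient restriction, as in
  \<open>eff_sequencewise\<close>.\<close>

lemma eff_collect:
  assumes "approximable A" "\<And>p q n. F p = Some q \<Longrightarrow> A n p = Some (component n q)"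
  shows "eff F"
proof -
  obtain Q where Q: "tot 3 Q"
    "\<And>n p r. A n p = Some r \<Longrightarrow> approximates (\<lambda>t x. Q p [t, n, x]) r"
    using assms(1) unfolding approximable_def by blast
  define \<phi> where "\<phi> p xs = Q p [xs ! 0, fst (untuple (xs ! 1)), snd (untuple (xs ! 1))]" for p xs
  have "tot 2 \<phi>"
    unfolding \<phi>_def by (intro tot_app3[OF Q(1)] tot_untuple tot_nth) simp_all
  moreover have *: "approximates (\<lambda>t x. Q p [t, n, x]) (component n q)" if "F p = Some q" for p q n
    using that assms(2) Q(2) by blast
  moreover have "\<exists>t. \<phi> p [t, k] \<noteq> 0" if "F p = Some q" for p q k
  proof -
    have "\<forall>\<^sub>F t in sequentially. Q p [t, fst (untuple k), snd (untuple k)]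
        = Suc (component (fst (untuple k)) q (snd (untuple k)))"
      using *[OF that] unfolding approximates_def by blast
    then have "\<forall>\<^sub>F t in sequentially. \<phi> p [t, k] = Suc (q k)"
      by (simp add: \<phi>_def component_def)
    then have "\<forall>\<^sub>F t in sequentially. \<phi> p [t, k] \<noteq> 0" by eventually_elim simp
    then show ?thesis unfolding eventually_sequentially by blast
  qed
  moreover have "\<phi> p [t, k] = Suc (q k)" if "F p = Some q" "\<phi> p [t, k] \<noteq> 0" for p q k t
  proof -
    have "Q p [t, fst (untuple k), snd (untuple k)] = Suc (component (fst (untuple k)) q (snd (untuple k)))"
      using *[OF that(1)] that(2) unfolding approximates_def \<phi>_def by simp
    then show ?thesis by (simp add: \<phi>_def component_def)
  qed
  ultimately show ?thesis using eff_search[of \<phi> F] by blast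
qed

text \<open>Reindexing by \<open>tuple_index\<close> turns the constant sequence into the sequence
  of components of \<open>F p\<close>, to which \<open>eff_collect\<close> applies.\<close>

lemma eff_approximable:
  assumes "approximable (\<lambda>n. F)"
  shows "eff F"
proof (rule eff_collect)
  have "tot 2 (\<lambda>p xs. tuple_index (xs ! 0) (xs ! 1))"
    by (intro tot_tuple_index tot_nth) simp_all
  from approximable_reindex[OF assms _ this, of id]
  show "approximable (\<lambda>n p. map_option (\<lambda>r x. r (tuple_index n x)) (F p))"
    by (simp add: tot_nth)
qed (simp add: component_def [abs_def])

lemma eff_total:
  assumes "tot 1 (\<lambda>p xs. \<phi> p (xs ! 0))"
  shows "eff (\<lambda>p. Some (\<phi> p))"
proof (rule eff_approximable, rule approximable_total)
  have "tot 2 (\<lambda>p xs. \<phi> p ([xs ! 1] ! 0))"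
    by (rule tot_comp[OF assms]) (auto intro: tot_nth)
  then show "tot 2 (\<lambda>p xs. \<phi> p (xs ! 1))" by simp
qed

text \<open>The odd places hold the second half of a \<open>pair\<close>; a strong reduction becomes
  an ordinary one by ignoring the first half.\<close>

lemma eff_snd:
  assumes "eff F"
  shows "eff (\<lambda>p. F (\<lambda>k. p (2 * k + 1)))"
proof -
  have "tot 2 (\<lambda>p xs. p (xs ! 1 + xs ! 1 + 1))"
    by (intro tot_query tot_add tot_nth tot_const) simp_all
  then have "approximable (\<lambda>n p. Some (\<lambda>k. p (2 * k + 1)))"
    by (intro approximable_total) (simp add: mult_2)
  from approximable_comp[OF assms this] show ?thesis
    by (intro eff_approximable) (simp add: map_comp_def)
qed

text \<open>Stage \<open>t\<close> inspects \<open>p t\<close>, which yields entry \<open>k\<close>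
  of \<open>p - 1\<close> if it is nonzero and preceded by exactly \<open>k\<close> nonzero entries.
  Being one larger than that entry, it already has the form required by
  \<open>eff_search\<close>.\<close>

lemma eff_minus_one: "eff minus_one"
proof -
  define count where "count p t = rec_nat 0 (\<lambda>m c. if p m = 0 then c else Suc c) t" for p :: baire and t
  have count: "count p t = card {i. p i \<noteq> 0 \<and> i < t}" for p t
    by (induction t) (simp_all add: count_def card_below_Suc)
  define \<phi> where "\<phi> p xs = (if count p (xs ! 0) = xs ! 1 then p (xs ! 0) else 0)" for p xs
  have "tot 2 \<phi>"
    unfolding \<phi>_def count_def
    by (intro tot_if_eq tot_rec_nat tot_if_zero tot_query tot_Suc tot_zero tot_nth) simp_all
  moreover have "\<exists>t. \<phi> p [t, k] \<noteq> 0" and "\<And>t. \<phi> p [t, k] \<noteq> 0 \<Longrightarrow> \<phi> p [t, k] = Suc (q k)"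
    if "minus_one p = Some q" for p q k
  proof -
    let ?S = "{t. p t \<noteq> 0}"
    have inf: "infinite ?S" and q: "q k = p (enumerate ?S k) - 1"
      using that by (auto simp: minus_one_def Let_def split: if_splits)
    show "\<exists>t. \<phi> p [t, k] \<noteq> 0"
      using card_enumerate_below[OF inf, of k] enumerate_in_set[OF inf, of k]
      by (intro exI[of _ "enumerate ?S k"]) (simp add: \<phi>_def count)
    fix t assume "\<phi> p [t, k] \<noteq> 0"
    then have t: "card {i. p i \<noteq> 0 \<and> i < t} = k" "p t \<noteq> 0"
      by (auto simp: \<phi>_def count split: if_splits)
    then have "enumerate ?S k = t"
      using enumerate_card_below[OF inf, of t] by simp
    then show "\<phi> p [t, k] = Suc (q k)"
      using q t by (simp add: \<phi>_def count)
  qed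
  ultimately show ?thesis using eff_search[of \<phi> minus_one] by blast
qed

text \<open>
  All the computations run in parallel: at stage \<open>t\<close> the output for the index \<open>n\<close> is the next missing
  value of \<open>A n p\<close>, increased by one, if it is known by then, and \<open>0\<close> otherwise. Thus the output is
  total, even where \<open>A n p\<close> is undefined.
\<close>

lemma approximable_completion:
  assumes "approximable A"
  shows "\<exists>D. eff (\<lambda>p. Some (D p)) \<and>
    (\<forall>n p r. A n p = Some r \<longrightarrow> minus_one (component n (D p)) = Some r)"
proof -
  obtain Q where Q: "tot 3 Q"
    "\<And>n p r. A n p = Some r \<Longrightarrow> approximates (\<lambda>t x. Q p [t, n, x]) r"
    using assms unfolding approximable_def by blast
  define count where
    "count p n t = rec_nat 0 (\<lambda>m c. if Q p [m, n, c] = 0 then c else Suc c) t" for p n t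
  define out where "out p n t = Q p [t, n, count p n t]" for p n t
  define D where "D p k = out p (fst (untuple k)) (snd (untuple k))" for p k
  have "tot 1 (\<lambda>p xs. D p (xs ! 0))"
    unfolding D_def out_def count_def
    by (intro tot_app3[OF Q(1)] tot_rec_nat tot_if_zero tot_untuple tot_Suc tot_zero tot_nth
        tot_drop_nth) simp_all
  then have "eff (\<lambda>p. Some (D p))" by (rule eff_total)
  moreover have "minus_one (component n (D p)) = Some r" if A: "A n p = Some r" for n p r
  proof -
    have Qr: "Q p [t, n, x] \<noteq> 0 \<Longrightarrow> Q p [t, n, x] = Suc (r x)"
      "\<forall>\<^sub>F t in sequentially. Q p [t, n, x] = Suc (r x)" for t x
      using Q(2)[OF A] by (auto simp: approximates_def)
    have count: "count p n t = card {i. out p n i \<noteq> 0 \<and> i < t}" for t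
      by (induction t) (simp_all add: count_def out_def card_below_Suc)
    \<comment> \<open>If the output ceased, the counter would stay at some index forever, although
      the value at that index is eventually known.\<close>
    have "infinite {t. out p n t \<noteq> 0}"
    proof
      assume fin: "finite {t. out p n t \<noteq> 0}"
      then obtain N where N: "\<forall>t \<in> {t. out p n t \<noteq> 0}. t < N"
        unfolding finite_nat_set_iff_bounded by blast
      have "count p n t = count p n N" if "t \<ge> N" for t
      proof -
        have "{i. out p n i \<noteq> 0 \<and> i < t} = {i. out p n i \<noteq> 0 \<and> i < N}"
          using N that less_le_trans by blast
        then show ?thesis by (simp only: count)
      qed
      moreover have "out p n t = 0" if "t \<ge> N" for t
        using N that by (metis leD mem_Collect_eq)
      ultimately have "Q p [t, n, count p n N] = 0" if "t \<ge> N" for t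
        using that unfolding out_def by metis
      then have "\<forall>\<^sub>F t in sequentially. Q p [t, n, count p n N] = 0"
        unfolding eventually_sequentially by blast
      with Qr(2)[of "count p n N"] have "\<forall>\<^sub>F t :: nat in sequentially. False"
        by eventually_elim simp
      then show False by simp
    qed
    moreover have "out p n t = Suc (r (card {i. out p n i \<noteq> 0 \<and> i < t}))"
      if "out p n t \<noteq> 0" for t
      using that Qr(1) unfolding count [symmetric] by (simp add: out_def)
    ultimately have "minus_one (out p n) = Some r" by (rule minus_one_eq)
    moreover have "component n (D p) = out p n"
      by (rule ext) (simp add: component_def D_def)
    ultimately show ?thesis by simp
  qed
  ultimately show ?thesis by blast
qed

end

section \<open>Reductions between stashed problems\<close>

text \<open>
  Both reducibilities in terms of single names: \<open>h p q = H q\<close> for the strong one and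
  \<open>h p q = H \<langle>p, q\<rangle>\<close> for the ordinary one.
\<close>

definition reduces ::
    "(baire \<Rightarrow> baire \<rightharpoonup> baire) \<Rightarrow> (baire \<rightharpoonup> baire) \<Rightarrow> ('a, 'b) mvfun \<Rightarrow> ('c, 'd) mvfun \<Rightarrow> bool" where
  "reduces h K f g \<longleftrightarrow> (\<forall>p x. in_rep f p = Some x \<longrightarrow> x \<in> mdom f \<longrightarrow>
    (\<exists>k z. K p = Some k \<and> in_rep g k = Some z \<and> z \<in> mdom g \<and>
      (\<forall>q y. out_rep g q = Some y \<longrightarrow> y \<in> vals g z \<longrightarrow>
        (\<exists>s w. h p q = Some s \<and> out_rep f s = Some w \<and> w \<in> vals f x))))"

lemma reducesD:
  assumes "reduces h K f g" "in_rep f p = Some x" "x \<in> mdom f"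
  obtains k z where "K p = Some k" "in_rep g k = Some z" "z \<in> mdom g"
    "\<And>q y. out_rep g q = Some y \<Longrightarrow> y \<in> vals g z
      \<Longrightarrow> \<exists>s w. h p q = Some s \<and> out_rep f s = Some w \<and> w \<in> vals f x"
  using assms unfolding reduces_def by blast

lemma realizer_reduces:
  assumes "reduces h K f g" "realizer G g"
  shows "realizer (\<lambda>p. Option.bind (K p) (\<lambda>k. Option.bind (G k) (h p))) f"
  unfolding realizer_def
proof (intro allI impI, elim conjE)
  fix p x assume p: "in_rep f p = Some x" "x \<in> mdom f"
  obtain k z where k: "K p = Some k" "in_rep g k = Some z" "z \<in> mdom g"
    "\<And>q y. out_rep g q = Some y \<Longrightarrow> y \<in> vals g z
      \<Longrightarrow> \<exists>s w. h p q = Some s \<and> out_rep f s = Some w \<and> w \<in> vals f x"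
    using reducesD[OF assms(1) p] by metis
  obtain q y where q: "G k = Some q" "out_rep g q = Some y" "y \<in> vals g z"
    using assms(2) k(2,3) unfolding realizer_def by blast
  then show "\<exists>q y. Option.bind (K p) (\<lambda>k. Option.bind (G k) (h p)) = Some q \<and>
      out_rep f q = Some y \<and> y \<in> vals f x"
    using k(4)[OF q(2,3)] by (simp add: k(1) q(1))
qed

text \<open>
  A realizer of \<open>g\<close> can be made undefined off the names of points of the domain of \<open>g\<close>, and its value
  at a single name can be replaced by any other correct one.
\<close>

lemma reduces_realizer:
  assumes G\<^sub>0: "realizer G\<^sub>0 g"
    and all: "\<And>G. realizer G g
      \<Longrightarrow> realizer (\<lambda>p. Option.bind (K p) (\<lambda>k. Option.bind (G k) (h p))) f"
  shows "reduces h K f g"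
  unfolding reduces_def
proof (intro allI impI)
  fix p x assume p: "in_rep f p = Some x" "x \<in> mdom f"
  define G where "G k = (if \<exists>z. in_rep g k = Some z \<and> z \<in> mdom g then G\<^sub>0 k else None)" for k
  have G: "realizer G g" using G\<^sub>0 by (simp add: realizer_def G_def)
  \<comment> \<open>Since \<open>G\<close> is undefined elsewhere, convergence forces
    \<open>K p\<close> to be a name of a point in the domain of \<open>g\<close>.\<close>
  obtain q where "Option.bind (K p) (\<lambda>k. Option.bind (G k) (h p)) = Some q"
    using all[OF G] p unfolding realizer_def by blast
  then obtain k where k: "K p = Some k" "G k \<noteq> None"
    by (auto simp: bind_eq_Some_conv)
  then obtain z where z: "in_rep g k = Some z" "z \<in> mdom g"
    by (auto simp: G_def split: if_splits)
  have "\<exists>s w. h p q = Some s \<and> out_rep f s = Some w \<and> w \<in> vals f x"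
    if "out_rep g q = Some y" "y \<in> vals g z" for q y
  proof -
    \<comment> \<open>The modified function is still a realizer, so \<open>h p\<close> must cope
      with every correct answer \<open>q\<close>, not only with the one chosen by
      \<open>G\<close>.\<close>
    have "realizer (G(k \<mapsto> q)) g"
      using G that z unfolding realizer_def by simp
    from all[OF this] obtain s w
      where "Option.bind (K p) (\<lambda>k'. Option.bind ((G(k \<mapsto> q)) k') (h p)) = Some s"
        "out_rep f s = Some w" "w \<in> vals f x"
      using p unfolding realizer_def by blast
    then show ?thesis using k(1) by auto
  qed
  then show "\<exists>k z. K p = Some k \<and> in_rep g k = Some z \<and> z \<in> mdom g \<and>
      (\<forall>q y. out_rep g q = Some y \<longrightarrow> y \<in> vals g z \<longrightarrow>
        (\<exists>s w. h p q = Some s \<and> out_rep f s = Some w \<and> w \<in> vals f x))"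
    using k(1) z by blast
qed

lemma map_comp_eq_bind: "H \<circ>\<^sub>m (G \<circ>\<^sub>m K) = (\<lambda>p. Option.bind (K p) (\<lambda>k. Option.bind (G k) H))"
  by (rule ext) (simp add: map_comp_def split: option.split)

lemma map_comp_pair_id_eq_bind:
  "H \<circ>\<^sub>m pair_id (G \<circ>\<^sub>m K) =
    (\<lambda>p. Option.bind (K p) (\<lambda>k. Option.bind (G k) (\<lambda>q. H (pair p q))))"
  by (rule ext) (simp add: map_comp_def pair_id_def split: option.split)

lemma strongly_reducible_viaI:
  assumes "C H" "C K" "reduces (\<lambda>p. H) K f g"
  shows "strongly_reducible_via C f g"
  unfolding strongly_reducible_via_def map_comp_eq_bind
  using assms(1,2) realizer_reduces[OF assms(3)] by (intro exI[of _ H] exI[of _ K]) simp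

lemma reducible_viaI:
  assumes "C H" "C K" "reduces (\<lambda>p q. H (pair p q)) K f g"
  shows "reducible_via C f g"
  unfolding reducible_via_def map_comp_pair_id_eq_bind
  using assms(1,2) realizer_reduces[OF assms(3)] by (intro exI[of _ H] exI[of _ K]) simp

text \<open>\<open>problem g\<close> supplies a realizer; without one the condition on all
  \<open>G\<close> would be vacuous and say nothing about \<open>K\<close>.\<close>

lemma strongly_reducible_viaE:
  assumes "strongly_reducible_via C f g" "problem g"
  obtains H K where "C H" "C K" "reduces (\<lambda>p. H) K f g"
proof -
  obtain H K where HK: "C H" "C K" and all: "\<And>G. realizer G g
      \<Longrightarrow> realizer (\<lambda>p. Option.bind (K p) (\<lambda>k. Option.bind (G k) H)) f"
    using assms(1) unfolding strongly_reducible_via_def map_comp_eq_bind by auto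
  obtain G where "realizer G g" using assms(2) by (auto simp: problem_def)
  then have "reduces (\<lambda>p. H) K f g" by (rule reduces_realizer) (rule all)
  then show thesis using HK that by simp
qed

lemma reducible_viaE:
  assumes "reducible_via C f g" "problem g"
  obtains H K where "C H" "C K" "reduces (\<lambda>p q. H (pair p q)) K f g"
proof -
  obtain H K where HK: "C H" "C K" and all: "\<And>G. realizer G g
      \<Longrightarrow> realizer (\<lambda>p. Option.bind (K p) (\<lambda>k. Option.bind (G k) (\<lambda>q. H (pair p q)))) f"
    using assms(1) unfolding reducible_via_def map_comp_pair_id_eq_bind by auto
  obtain G where "realizer G g" using assms(2) by (auto simp: problem_def)
  then have "reduces (\<lambda>p q. H (pair p q)) K f g" by (rule reduces_realizer) (rule all)
  then show thesis using HK that by simp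
qed

section \<open>Names, domain and values of a stashed problem\<close>

lemma in_rep_stash:
  "in_rep (stash f) p = Some x \<longleftrightarrow> (\<forall>n. in_rep f (component n p) = Some (x n))"
proof
  assume "in_rep (stash f) p = Some x"
  then have "\<forall>n. component n p \<in> dom (in_rep f)" "x = (\<lambda>n. the (in_rep f (component n p)))"
    by (auto simp: stash_def seq_rep_def split: if_splits)
  then show "\<forall>n. in_rep f (component n p) = Some (x n)" by (auto simp: domIff)
next
  assume "\<forall>n. in_rep f (component n p) = Some (x n)"
  then show "in_rep (stash f) p = Some x" by (auto simp: stash_def seq_rep_def)
qed

lemma completion_eq_bind: "completion \<delta> p = Some (Option.bind (minus_one p) \<delta>)"
  by (simp add: completion_def map_comp_def split: option.split)

lemma out_rep_stash:
  "out_rep (stash f) q = Some (\<lambda>n. Option.bind (minus_one (component n q)) (out_rep f))"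
  by (simp add: stash_def seq_rep_def dom_def completion_eq_bind)

text \<open>The embedding of a space into its completion, on names.\<close>

lemma minus_one_Suc: "minus_one (\<lambda>k. Suc (r k)) = Some r"
proof (rule minus_one_eq)
  show "infinite {t. Suc (r t) \<noteq> 0}" by simp
  have "{i. Suc (r i) \<noteq> 0 \<and> i < t} = {..<t}" for t by auto
  then show "Suc (r t) = Suc (r (card {i. Suc (r i) \<noteq> 0 \<and> i < t}))" for t by simp
qed

lemma ran_completion:
  assumes "\<And>w. y = Some w \<Longrightarrow> w \<in> ran \<delta>"
  shows "y \<in> ran (completion \<delta>)"
proof (cases y)
  case None
  have "completion \<delta> (\<lambda>k. 0) = Some None" by (simp add: completion_eq_bind minus_one_def)
  then show ?thesis unfolding None ran_def by blast
next
  case (Some w)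
  then obtain r where "\<delta> r = Some w" using assms by (auto simp: ran_def)
  then have "completion \<delta> (\<lambda>k. Suc (r k)) = Some (Some w)"
    by (simp add: completion_eq_bind minus_one_Suc)
  then show ?thesis unfolding Some ran_def by blast
qed

lemma mdom_stashD:
  assumes "x \<in> mdom (stash f)"
  shows "x n \<in> mdom f"
proof -
  obtain y where "y \<in> vals (stash f) x" using assms by (auto simp: mdom_def)
  then show ?thesis by (auto simp: stash_def split: if_splits)
qed

text \<open>One correct component makes a value of the stash, but it has to possess a name in the
  completed space, which the range hypothesis ensures.\<close>

lemma mdom_stash:
  assumes "\<And>x. vals f x \<subseteq> ran (out_rep f)"
  shows "x \<in> mdom (stash f) \<longleftrightarrow> (\<forall>n. x n \<in> mdom f)"
proof
  assume x: "\<forall>n. x n \<in> mdom f"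
  then obtain w where w: "w \<in> vals f (x 0)" by (auto simp: mdom_def)
  then have "Some w \<in> ran (completion (out_rep f))"
    using assms by (intro ran_completion) auto
  then have "(\<lambda>n. Some w) \<in> vals (stash f) x"
    using x w by (auto simp: stash_def)
  then show "x \<in> mdom (stash f)" by (auto simp: mdom_def)
qed (simp add: mdom_stashD)

text \<open>Provides the range hypothesis of \<open>mdom_stash\<close> for \<open>stash f\<close>,
  as the double stash requires.\<close>

lemma vals_stash_subset_ran: "vals (stash f) x \<subseteq> ran (out_rep (stash f))"
proof
  fix y assume "y \<in> vals (stash f) x"
  then have "\<forall>n. \<exists>c. completion (out_rep f) c = Some (y n)"
    by (auto simp: stash_def ran_def split: if_splits)
  then obtain c where c: "\<And>n. completion (out_rep f) (c n) = Some (y n)" by metis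
  define q where "q k = c (fst (untuple k)) (snd (untuple k))" for k
  have "component n q = c n" for n
    by (rule ext) (simp add: component_def q_def)
  then have "out_rep (stash f) q = Some y"
    using c by (auto simp: stash_def seq_rep_def)
  then show "y \<in> ran (out_rep (stash f))" by (auto simp: ran_def)
qed

text \<open>The range condition in \<open>stash\<close> is automatic for a value that has a name, so
  only the existence of one correct component remains.\<close>

lemma vals_stash_iff:
  assumes "\<forall>n. x n \<in> mdom f" "out_rep (stash f) q = Some y"
  shows "y \<in> vals (stash f) x \<longleftrightarrow>
    (\<exists>n r w. minus_one (component n q) = Some r \<and> out_rep f r = Some w \<and> w \<in> vals f (x n))"
proof -
  have y: "y n = Option.bind (minus_one (component n q)) (out_rep f)" for n
    using assms(2) by (auto simp: out_rep_stash)
  have "y n \<in> ran (completion (out_rep f))" for n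
    by (rule ran_completion) (auto simp: y bind_eq_Some_conv ran_def)
  then show ?thesis
    using assms(1) by (auto simp: stash_def y bind_eq_Some_conv)
qed

text \<open>Every question of a stash must be legal, so \<open>K'\<close> has to treat all
  components. Only one unknown component of the answer is correct, so \<open>h'\<close> has to be
  right just where stripping and \<open>h\<close> converge. The general \<open>h\<close> covers both
  reducibilities.\<close>

lemma reduces_stash:
  assumes red: "reduces h K f g"
    and g: "\<And>x. vals g x \<subseteq> ran (out_rep g)"
    and K': "\<And>p k. (\<And>n. K (component n p) = Some (k n))
      \<Longrightarrow> \<exists>s. K' p = Some s \<and> (\<forall>n. component n s = k n)"
    and h': "\<And>p q. \<exists>s. h' p q = Some s \<and> (\<forall>n r v. minus_one (component n q) = Some r
      \<longrightarrow> h (component n p) r = Some v \<longrightarrow> minus_one (component n s) = Some v)"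
  shows "reduces h' K' (stash f) (stash g)"
  unfolding reduces_def
proof (intro allI impI)
  fix p x assume p: "in_rep (stash f) p = Some x" and "x \<in> mdom (stash f)"
  then have x: "\<forall>n. x n \<in> mdom f" by (simp add: mdom_stashD)
  have "\<exists>k z. K (component n p) = Some k \<and> in_rep g k = Some z \<and> z \<in> mdom g \<and>
      (\<forall>q y. out_rep g q = Some y \<longrightarrow> y \<in> vals g z \<longrightarrow>
        (\<exists>s w. h (component n p) q = Some s \<and> out_rep f s = Some w \<and> w \<in> vals f (x n)))" for n
    using red p x unfolding reduces_def in_rep_stash by blast
  then obtain k z where k: "\<And>n. K (component n p) = Some (k n)"
    and z: "\<And>n. in_rep g (k n) = Some (z n)" "\<And>n. z n \<in> mdom g"
    and h: "\<And>n q y. out_rep g q = Some y \<Longrightarrow> y \<in> vals g (z n) \<Longrightarrow>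
        \<exists>s w. h (component n p) q = Some s \<and> out_rep f s = Some w \<and> w \<in> vals f (x n)"
    by metis
  obtain s where s: "K' p = Some s" "\<forall>n. component n s = k n" using K'[OF k] by blast
  moreover have "in_rep (stash g) s = Some z" using s(2) z(1) by (simp add: in_rep_stash)
  moreover have "z \<in> mdom (stash g)" using z(2) g by (simp add: mdom_stash)
  moreover have "\<exists>s w. h' p q = Some s \<and> out_rep (stash f) s = Some w \<and> w \<in> vals (stash f) x"
    if q: "out_rep (stash g) q = Some y" "y \<in> vals (stash g) z" for q y
  proof -
    obtain n r w where r: "minus_one (component n q) = Some r" "out_rep g r = Some w" "w \<in> vals g (z n)"
      using q(2) z(2) unfolding vals_stash_iff[OF allI q(1), OF z(2)] by blast
    obtain v w' where v: "h (component n p) r = Some v" "out_rep f v = Some w'" "w' \<in> vals f (x n)"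
      using h[OF r(2,3)] by blast
    obtain s' where s': "h' p q = Some s'" "minus_one (component n s') = Some v"
      using h'[of p q] r(1) v(1) by blast
    obtain y' where y': "out_rep (stash f) s' = Some y'" by (simp add: out_rep_stash)
    then have "y' \<in> vals (stash f) x"
      using vals_stash_iff[OF x y'] s'(2) v(2,3) by blast
    then show ?thesis using s'(1) y' by blast
  qed
  ultimately show "\<exists>k z. K' p = Some k \<and> in_rep (stash g) k = Some z \<and> z \<in> mdom (stash g) \<and>
      (\<forall>q y. out_rep (stash g) q = Some y \<longrightarrow> y \<in> vals (stash g) z \<longrightarrow>
        (\<exists>s w. h' p q = Some s \<and> out_rep (stash f) s = Some w \<and> w \<in> vals (stash f) x))"
    by blast
qed

section \<open>The three properties of an interior operator\<close>

context effective_class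
begin

lemma reducible_via_if_strongly:
  assumes "eff H" "eff K" "reduces (\<lambda>p. H) K f g"
  shows "reducible_via eff f g"
proof (rule reducible_viaI[OF eff_snd[OF assms(1)] assms(2)])
  have "(\<lambda>k. pair p q (2 * k + 1)) = q" for p q by (simp add: pair_def)
  then show "reduces (\<lambda>p q. H (\<lambda>k. pair p q (2 * k + 1))) K f g" using assms(3) by simp
qed

text \<open>The answer, raised by one to enter the completion, is copied into every component; only
  component \<open>0\<close> has to be correct.\<close>

lemma stash_le:
  obtains H K where "eff H" "eff K" "reduces (\<lambda>p. H) K (stash f) f"
proof
  show "eff (\<lambda>q. Some (\<lambda>k. Suc (q (snd (untuple k)))))"
    by (intro eff_total tot_Suc tot_query tot_snd_untuple tot_nth) simp
  show "eff (\<lambda>p. Some (component 0 p))"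
    unfolding component_def by (intro eff_total tot_query tot_tuple_index tot_const tot_nth) simp
  show "reduces (\<lambda>p q. Some (\<lambda>k. Suc (q (snd (untuple k))))) (\<lambda>p. Some (component 0 p)) (stash f) f"
    unfolding reduces_def
  proof (intro allI impI)
    fix p x assume p: "in_rep (stash f) p = Some x" and "x \<in> mdom (stash f)"
    then have x: "\<forall>n. x n \<in> mdom f" by (simp add: mdom_stashD)
    have "\<exists>w. out_rep (stash f) (\<lambda>k. Suc (q (snd (untuple k)))) = Some w \<and> w \<in> vals (stash f) x"
      if "out_rep f q = Some y" "y \<in> vals f (x 0)" for q y
    proof -
      define s where "s k = Suc (q (snd (untuple k)))" for k
      have "component 0 s = (\<lambda>k. Suc (q k))"
        by (rule ext) (simp add: component_def s_def)
      then have "minus_one (component 0 s) = Some q" by (simp add: minus_one_Suc)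
      moreover obtain w where w: "out_rep (stash f) s = Some w" by (simp add: out_rep_stash)
      ultimately have "w \<in> vals (stash f) x"
        using vals_stash_iff[OF x w] that by blast
      then show ?thesis using w unfolding s_def by blast
    qed
    then show "\<exists>k z. Some (component 0 p) = Some k \<and> in_rep f k = Some z \<and> z \<in> mdom f \<and>
        (\<forall>q y. out_rep f q = Some y \<longrightarrow> y \<in> vals f z \<longrightarrow>
          (\<exists>s w. Some (\<lambda>k. Suc (q (snd (untuple k)))) = Some s \<and>
            out_rep (stash f) s = Some w \<and> w \<in> vals (stash f) x))"
      using p x by (intro exI[of _ "component 0 p"] exI[of _ "x 0"]) (simp add: in_rep_stash)
  qed
qed

lemma eff_sequencewise:
  assumes "eff K"
  obtains K' where "eff K'" "\<And>p k. (\<And>n. K (component n p) = Some (k n))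
      \<Longrightarrow> \<exists>s. K' p = Some s \<and> (\<forall>n. component n s = k n)"
proof
  define c where "c p k = the (K (component (fst (untuple k)) p)) (snd (untuple k))" for p k
  \<comment> \<open>Where some component diverges, the filler \<open>the None\<close> in
    \<open>c\<close> would be a value that no computation delivers; such \<open>p\<close> are left
    out of the domain.\<close>
  define K' where "K' p = (if \<forall>n. K (component n p) \<noteq> None then Some (c p) else None)" for p
  have c: "component n (c p) = the (K (component n p))" for n p
    by (rule ext) (simp add: component_def [of n "c p"] c_def)
  have K': "component n s = the (K (component n p))" "K (component n p) \<noteq> None"
    if "K' p = Some s" for p s n
  proof -
    have "s = c p" "\<forall>n. K (component n p) \<noteq> None"
      using that unfolding K'_def by (metis option.distinct(1) option.inject)+
    then show "component n s = the (K (component n p))" "K (component n p) \<noteq> None"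
      using c by blast+
  qed
  show "eff K'"
  proof (rule eff_collect[OF approximable_comp[OF assms approximable_component]])
    show "(K \<circ>\<^sub>m (\<lambda>p. Some (component n p))) p = Some (component n q)" if "K' p = Some q" for p q n
      using K'[OF that, of n] by auto
  qed
  fix p k assume k: "\<And>n. K (component n p) = Some (k n)"
  then obtain s where s: "K' p = Some s" by (simp add: K'_def)
  have "component n s = k n" for n using K'(1)[OF s, of n] k[of n] by simp
  then show "\<exists>s. K' p = Some s \<and> (\<forall>n. component n s = k n)" using s by blast
qed

lemma stash_mono_strong:
  assumes "eff H" "eff K" "reduces (\<lambda>p. H) K f g" "problem g"
  obtains H' K' where "eff H'" "eff K'" "reduces (\<lambda>p. H') K' (stash f) (stash g)"
proof -
  obtain K' where K': "eff K'" "\<And>p k. (\<And>n. K (component n p) = Some (k n))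
      \<Longrightarrow> \<exists>s. K' p = Some s \<and> (\<forall>n. component n s = k n)"
    using eff_sequencewise[OF assms(2)] by blast
  \<comment> \<open>The computation for component \<open>n\<close> strips the completion and applies
    \<open>H\<close>; it is guaranteed to converge for at least one \<open>n\<close> only.\<close>
  have "approximable (\<lambda>n. H \<circ>\<^sub>m (minus_one \<circ>\<^sub>m (\<lambda>q. Some (component n q))))"
    by (intro approximable_comp assms(1) eff_minus_one approximable_component)
  from approximable_completion[OF this] obtain D where D: "eff (\<lambda>q. Some (D q))"
    "\<And>n q v. (H \<circ>\<^sub>m (minus_one \<circ>\<^sub>m (\<lambda>q. Some (component n q)))) q = Some v
      \<Longrightarrow> minus_one (component n (D q)) = Some v"
    by blast
  have "reduces (\<lambda>p q. Some (D q)) K' (stash f) (stash g)"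
  proof (rule reduces_stash[OF assms(3)])
    show "vals g x \<subseteq> ran (out_rep g)" for x using assms(4) by (simp add: problem_def)
    have "minus_one (component n (D q)) = Some v"
      if "minus_one (component n q) = Some r" "H r = Some v" for n q r v
      by (rule D(2)) (simp add: that)
    then show "\<exists>s. Some (D q) = Some s \<and> (\<forall>n r v. minus_one (component n q) = Some r
        \<longrightarrow> H r = Some v \<longrightarrow> minus_one (component n s) = Some v)" for q
      by blast
  qed (rule K'(2))
  then show thesis using D(1) K'(1) that by blast
qed

lemma stash_mono:
  assumes "eff H" "eff K" "reduces (\<lambda>p q. H (pair p q)) K f g" "problem g"
  obtains H' K' where "eff H'" "eff K'" "reduces (\<lambda>p q. H' (pair p q)) K' (stash f) (stash g)"
proof -
  obtain K' where K': "eff K'" "\<And>p k. (\<And>n. K (component n p) = Some (k n))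
      \<Longrightarrow> \<exists>s. K' p = Some s \<and> (\<forall>n. component n s = k n)"
    using eff_sequencewise[OF assms(2)] by blast
  \<comment> \<open>With \<open>u = pair p q\<close>, the maps \<open>P n\<close> and
    \<open>R n\<close> give the original input and the completed answer in component
    \<open>n\<close>. Only the latter is stripped before both are paired for
    \<open>H\<close>.\<close>
  define P where "P n u = component n (\<lambda>k. u (2 * k))" for n and u :: baire
  define R where "R n u = component n (\<lambda>k. u (2 * k + 1))" for n and u :: baire
  have "tot 2 (\<lambda>p xs. p (tuple_index (xs ! 0) (xs ! 1) + tuple_index (xs ! 0) (xs ! 1)))"
    by (intro tot_query tot_add tot_tuple_index tot_nth) simp_all
  then have P: "approximable (\<lambda>n u. Some (P n u))"
    by (intro approximable_total) (simp add: P_def component_def mult_2)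
  have "tot 2 (\<lambda>p xs. p (tuple_index (xs ! 0) (xs ! 1) + tuple_index (xs ! 0) (xs ! 1) + 1))"
    by (intro tot_query tot_add tot_tuple_index tot_nth tot_const) simp_all
  then have R: "approximable (\<lambda>n u. Some (R n u))"
    by (intro approximable_total) (simp add: R_def component_def mult_2)
  have "approximable (\<lambda>n. H \<circ>\<^sub>m (\<lambda>u. Option.bind (Some (P n u))
      (\<lambda>a. map_option (pair a) ((minus_one \<circ>\<^sub>m (\<lambda>u. Some (R n u))) u))))"
    by (intro approximable_comp approximable_pair assms(1) eff_minus_one P R)
  from approximable_completion[OF this] obtain D where D: "eff (\<lambda>u. Some (D u))"
    "\<And>n u v. (H \<circ>\<^sub>m (\<lambda>u. Option.bind (Some (P n u))
      (\<lambda>a. map_option (pair a) ((minus_one \<circ>\<^sub>m (\<lambda>u. Some (R n u))) u)))) u = Some v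
      \<Longrightarrow> minus_one (component n (D u)) = Some v"
    by blast
  have PR: "P n (pair p q) = component n p" "R n (pair p q) = component n q" for n p q
    by (simp_all add: P_def R_def pair_def)
  have "reduces (\<lambda>p q. Some (D (pair p q))) K' (stash f) (stash g)"
  proof (rule reduces_stash[OF assms(3)])
    show "vals g x \<subseteq> ran (out_rep g)" for x using assms(4) by (simp add: problem_def)
    have "minus_one (component n (D (pair p q))) = Some v"
      if "minus_one (component n q) = Some r" "H (pair (component n p) r) = Some v" for n p q r v
      by (rule D(2)) (simp add: that PR)
    then show "\<exists>s. Some (D (pair p q)) = Some s \<and> (\<forall>n r v. minus_one (component n q) = Some r
        \<longrightarrow> H (pair (component n p) r) = Some v \<longrightarrow> minus_one (component n s) = Some v)" for p q
      by blast
  qed (rule K'(2))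
  then show thesis using D(1) K'(1) that by blast
qed

lemma stash_le_stash_stash:
  assumes "problem f"
  obtains H K where "eff H" "eff K" "reduces (\<lambda>p. H) K (stash f) (stash (stash f))"
proof -
  define K where "K p k = p (tuple_index
    (tuple_index (fst (untuple k)) (fst (untuple (snd (untuple k))))) (snd (untuple (snd (untuple k)))))"
    for p :: baire and k
  have K: "component i (component n (K p)) = component (tuple_index n i) p" for i n p
    by (rule ext) (simp add: K_def component_def)
  have "eff (\<lambda>p. Some (K p))"
    unfolding K_def by (intro eff_total tot_query tot_tuple_index tot_untuple tot_nth) simp_all
  \<comment> \<open>\<open>m\<close> codes a row and a column. An answer carries two nested
    completions: the outer one is stripped from the row, the column is selected, and the inner one
    is stripped. Either stripping may fail, so the result has to be completed anew by
    \<open>D\<close>.\<close>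
  define A where "A m = minus_one \<circ>\<^sub>m (\<lambda>q. map_option (component (snd (untuple m)))
    ((minus_one \<circ>\<^sub>m (\<lambda>q. Some (component (fst (untuple m)) q))) q))" for m
  have "approximable (\<lambda>m q. map_option (\<lambda>r x. r (tuple_index (snd (untuple m)) x))
      ((minus_one \<circ>\<^sub>m (\<lambda>q. Some (component (fst (untuple m)) q))) q))"
    by (intro approximable_reindex[OF approximable_comp[OF eff_minus_one approximable_component]]
        tot_untuple tot_tuple_index tot_nth) simp_all
  then have "approximable A"
    unfolding A_def component_def [abs_def] by (intro approximable_comp eff_minus_one)
  from approximable_completion[OF this] obtain D where D: "eff (\<lambda>q. Some (D q))"
    "\<And>m q r. A m q = Some r \<Longrightarrow> minus_one (component m (D q)) = Some r"
    by blast
  have "reduces (\<lambda>p q. Some (D q)) (\<lambda>p. Some (K p)) (stash f) (stash (stash f))"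
    unfolding reduces_def
  proof (intro allI impI)
    fix p x assume p: "in_rep (stash f) p = Some x" and "x \<in> mdom (stash f)"
    then have x: "\<forall>n. x n \<in> mdom f" by (simp add: mdom_stashD)
    define z where "z n i = x (tuple_index n i)" for n i
    have z: "z n \<in> mdom (stash f)" for n
      using x assms by (subst mdom_stash) (auto simp: problem_def z_def)
    have "in_rep (stash (stash f)) (K p) = Some z"
      using p by (simp add: in_rep_stash K z_def)
    moreover have "z \<in> mdom (stash (stash f))"
      using z by (subst mdom_stash) (auto intro: vals_stash_subset_ran [THEN subsetD])
    moreover have "\<exists>w. out_rep (stash f) (D q) = Some w \<and> w \<in> vals (stash f) x"
      if q: "out_rep (stash (stash f)) q = Some y" "y \<in> vals (stash (stash f)) z" for q y
    proof -
      obtain n r Y where r: "minus_one (component n q) = Some r" "out_rep (stash f) r = Some Y"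
        "Y \<in> vals (stash f) (z n)"
        using q z vals_stash_iff[of z "stash f"] by blast
      have "\<forall>i. z n i \<in> mdom f" using x by (simp add: z_def)
      then obtain i s w where s: "minus_one (component i r) = Some s" "out_rep f s = Some w"
        "w \<in> vals f (z n i)"
        using r(2,3) vals_stash_iff by blast
      have "A (tuple_index n i) q = Some s" using r(1) s(1) by (simp add: A_def)
      then have "minus_one (component (tuple_index n i) (D q)) = Some s" by (rule D(2))
      moreover obtain W where W: "out_rep (stash f) (D q) = Some W" by (simp add: out_rep_stash)
      ultimately have "W \<in> vals (stash f) x"
        using vals_stash_iff[OF x W] s(2,3) unfolding z_def by blast
      then show ?thesis using W by blast
    qed
    ultimately show "\<exists>k z. Some (K p) = Some k \<and> in_rep (stash (stash f)) k = Some z \<and>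
        z \<in> mdom (stash (stash f)) \<and>
        (\<forall>q y. out_rep (stash (stash f)) q = Some y \<longrightarrow> y \<in> vals (stash (stash f)) z \<longrightarrow>
          (\<exists>s w. Some (D q) = Some s \<and> out_rep (stash f) s = Some w \<and> w \<in> vals (stash f) x))"
      by blast
  qed
  then show thesis using \<open>eff (\<lambda>p. Some (K p))\<close> D(1) that by blast
qed

theorem stash_interior:
  assumes f: "problem f" and g: "problem g"
  shows "reducible_via eff (stash f) f"
    and "strongly_reducible_via eff (stash f) f"
    and "reducible_via eff f g \<Longrightarrow> reducible_via eff (stash f) (stash g)"
    and "strongly_reducible_via eff f g \<Longrightarrow> strongly_reducible_via eff (stash f) (stash g)"
    and "reducible_via eff (stash f) (stash (stash f))"
    and "strongly_reducible_via eff (stash f) (stash (stash f))"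
proof -
  obtain H K where "eff H" "eff K" "reduces (\<lambda>p. H) K (stash f) f" by (rule stash_le)
  then show "reducible_via eff (stash f) f" "strongly_reducible_via eff (stash f) f"
    using reducible_via_if_strongly strongly_reducible_viaI[of eff] by metis+
  obtain H K where "eff H" "eff K" "reduces (\<lambda>p. H) K (stash f) (stash (stash f))"
    using f by (rule stash_le_stash_stash)
  then show "reducible_via eff (stash f) (stash (stash f))"
    "strongly_reducible_via eff (stash f) (stash (stash f))"
    using reducible_via_if_strongly strongly_reducible_viaI[of eff] by metis+
  show "reducible_via eff (stash f) (stash g)" if red: "reducible_via eff f g"
  proof -
    obtain H K where "eff H" "eff K" "reduces (\<lambda>p q. H (pair p q)) K f g"
      using red g by (rule reducible_viaE)
    then obtain H' K' where "eff H'" "eff K'"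
      "reduces (\<lambda>p q. H' (pair p q)) K' (stash f) (stash g)"
      using g by (rule stash_mono)
    then show ?thesis by (rule reducible_viaI)
  qed
  show "strongly_reducible_via eff (stash f) (stash g)" if red: "strongly_reducible_via eff f g"
  proof -
    obtain H K where "eff H" "eff K" "reduces (\<lambda>p. H) K f g"
      using red g by (rule strongly_reducible_viaE)
    then obtain H' K' where "eff H'" "eff K'" "reduces (\<lambda>p. H') K' (stash f) (stash g)"
      using g by (rule stash_mono_strong)
    then show ?thesis by (rule strongly_reducible_viaI)
  qed
qed

end

theorem proposition1p7:
  fixes f :: "('a, 'b) mvfun" and g :: "('c, 'd) mvfun"
  assumes "problem f" and "problem g"
  shows "(stash f \<le>\<^sub>W f
        \<and> (f \<le>\<^sub>W g \<longrightarrow> stash f \<le>\<^sub>W stash g)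
        \<and> stash f \<le>\<^sub>W stash (stash f))
    \<and> (stash f \<le>\<^sub>s\<^sub>W f
        \<and> (f \<le>\<^sub>s\<^sub>W g \<longrightarrow> stash f \<le>\<^sub>s\<^sub>W stash g)
        \<and> stash f \<le>\<^sub>s\<^sub>W stash (stash f))
    \<and> (stash f \<le>\<^sub>W\<^sup>* f
        \<and> (f \<le>\<^sub>W\<^sup>* g \<longrightarrow> stash f \<le>\<^sub>W\<^sup>* stash g)
        \<and> stash f \<le>\<^sub>W\<^sup>* stash (stash f))
    \<and> (stash f \<le>\<^sub>s\<^sub>W\<^sup>* f
        \<and> (f \<le>\<^sub>s\<^sub>W\<^sup>* g \<longrightarrow> stash f \<le>\<^sub>s\<^sub>W\<^sup>* stash g)
        \<and> stash f \<le>\<^sub>s\<^sub>W\<^sup>* stash (stash f))"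
  unfolding W_le_def sW_le_def W_top_le_def sW_top_le_def
  using rec.stash_interior[OF assms] cont.stash_interior[OF assms] by blast

end
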